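(* Let $I$ be a compact non-degenerate interval and let $f\colon I\to I$ be a piecewise continuous piecewise monotone map (with finitely many pieces) that is transitive and satisfies $h(f)=\log\beta>0$. Then $f$ is conjugate, via an increasing homeomorphism $\psi\colon I\to[0,1]$, to some map $g\in\mathcal{CS}_\beta$, i.e. a piecewise continuous piecewise monotone map $g\colon[0,1]\to[0,1]$ of constant slope $\beta$.
   Context: "Monotone" means increasing or decreasing in the non-strict sense. A map $f\colon I\to I$ is piecewise continuous piecewise monotone if $I$ can be divided into finitely many non-degenerate closed intervals, any two having at most one point in common, on the interior of each of which $f$ is continuous and monotone. The maximal intervals on which $f$ is simultaneously continuous and monotone are called laps of $f$; they are closed and non-degenerate, and if maximal intervals overlap in more than a point they are shortened so that two laps have at most one common point. For a lap $J$, $f_J\colon J\to I$ denotes the continuous monotone map equal to $f$ in the interior of $J$, with values at the endpoints given by one-sided limits. Values at points of discontinuity are irrelevant: a common endpoint of two laps may have two images, and on each lap $J$ one uses $f_J$. Iterates are formed branchwise. Topological entropy: $h(f)=\lim_{n\to\infty}\frac1n\log c_n(f)$, where $c_n(f)$ is the number of laps of $f^n$. Transitive means that there is a point $x\in I$ whose $f$-trajectory is dense in $I$. $\mathcal{CS}_\beta$ is the class of piecewise continuous piecewise monotone maps $g\colon[0,1]\to[0,1]$ that are piecewise affine (finitely many pieces) with $|g'(x)|=\beta$ at every $x$ where $g$ is differentiable. Conjugacy via $\psi$ means $\psi\circ f=g\circ\psi$, understood lap by lap: for every lap $J$ of $f$ and $x\in J$, $\psi(f_J(x))=g_{\psi(J)}(\psi(x))$,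 where $g_{\psi(J)}$ agrees with $g$ on the interior of $\psi(J)$ and is given by one-sided limits at the endpoints. *)

theory Defs
  imports "HOL-Analysis.Analysis"
begin

definition nd_interval :: "real set \<Rightarrow> bool" where
  "nd_interval J \<longleftrightarrow> (\<exists>c d. c < d \<and> J = {c..d})"

definition cont_monotone_on :: "real set \<Rightarrow> (real \<Rightarrow> real) \<Rightarrow> bool" where
  "cont_monotone_on S f \<longleftrightarrow> continuous_on S f \<and> (mono_on S f \<or> antimono_on S f)"

text \<open>
  A map of an interval \<open>I\<close> is a function on the reals of which only the values on \<open>I\<close> matter.
  For non-degenerate closed intervals, having at most one common point is the same as having
  disjoint interiors, which is the condition built into \<open>division_of\<close>.
\<close>

definition pcpm :: "real set \<Rightarrow> (real \<Rightarrow> real) \<Rightarrow> bool" where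
  "pcpm I f \<longleftrightarrow> f ` I \<subseteq> I \<and>
     (\<exists>P. P division_of I \<and> (\<forall>J\<in>P. nd_interval J \<and> cont_monotone_on (interior J) f))"

text \<open>
  Only the interior of an interval is tested for continuity and monotonicity, because the value
  of \<open>f\<close> at a common endpoint of two laps is irrelevant.
\<close>

definition cm_interval :: "real set \<Rightarrow> (real \<Rightarrow> real) \<Rightarrow> real set \<Rightarrow> bool" where
  "cm_interval I f J \<longleftrightarrow> nd_interval J \<and> J \<subseteq> I \<and> cont_monotone_on (interior J) f"

definition max_cm_intervals :: "real set \<Rightarrow> (real \<Rightarrow> real) \<Rightarrow> real set set" where
  "max_cm_intervals I f =
     {J. cm_interval I f J \<and> (\<forall>K. cm_interval I f K \<and> J \<subseteq> K \<longrightarrow> K = J)}"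

text \<open>
  Two maximal intervals can overlap in more than a point (\<open>f\<close> is then constant on the overlap).
  In that case the overlap is given to the left one, and the right one is shortened.
  The closure restores the common endpoint; a maximal interval without such an overlap is unchanged.
\<close>

definition laps :: "real set \<Rightarrow> (real \<Rightarrow> real) \<Rightarrow> real set set" where
  "laps I f =
     (\<lambda>M. closure (M - \<Union>{M' \<in> max_cm_intervals I f. Inf M' < Inf M})) ` max_cm_intervals I f"

text \<open>The map \<open>f\<^sub>J\<close>: at an endpoint of \<open>J\<close> the limit below is the one-sided limit from inside \<open>J\<close>.\<close>

definition branch :: "(real \<Rightarrow> real) \<Rightarrow> real set \<Rightarrow> real \<Rightarrow> real" where
  "branch f J x = (if x \<in> interior J then f x else Lim (at x within interior J) f)"

text \<open>
  The branches of the \<open>n\<close>-th iterate, as pairs of a non-degenerate closed interval and a map to be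
  used on it: compositions \<open>f\<^sub>J\<close> of \<open>n\<close> lap maps, each on the interval where it is defined.
  The iterate itself has at \<open>x\<close> the common value of all branches whose interval contains \<open>x\<close>;
  where the branches disagree it is discontinuous and its value is irrelevant (here: unspecified).
  The pointwise iterate \<open>f ^^ n\<close> would not do, since an arbitrary value at a discontinuity
  of \<open>f\<close> could interrupt a lap of the iterate.
\<close>

primrec iter_branches ::
    "real set \<Rightarrow> (real \<Rightarrow> real) \<Rightarrow> nat \<Rightarrow> (real set \<times> (real \<Rightarrow> real)) set" where
  "iter_branches I f 0 = {(I, \<lambda>x. x)}"
| "iter_branches I f (Suc n) =
     {(K \<inter> \<phi> -` J, branch f J \<circ> \<phi>) | K \<phi> J.
        (K, \<phi>) \<in> iter_branches I f n \<and> J \<in> laps I f \<and> interior (K \<inter> \<phi> -` J) \<noteq> {}}"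

definition iterate :: "real set \<Rightarrow> (real \<Rightarrow> real) \<Rightarrow> nat \<Rightarrow> real \<Rightarrow> real" where
  "iterate I f n x = (THE y. \<forall>(K, \<phi>) \<in> iter_branches I f n. x \<in> K \<longrightarrow> \<phi> x = y)"

definition lap_number :: "real set \<Rightarrow> (real \<Rightarrow> real) \<Rightarrow> nat \<Rightarrow> nat" where
  "lap_number I f n = card (laps I (iterate I f n))"

definition has_entropy :: "real set \<Rightarrow> (real \<Rightarrow> real) \<Rightarrow> real \<Rightarrow> bool" where
  "has_entropy I f h \<longleftrightarrow> (\<lambda>n. ln (real (lap_number I f n)) / real n) \<longlonglongrightarrow> h"

text \<open>
  Pointwise iterates suffice here: a dense trajectory meets the finitely many discontinuities only
  finitely often (otherwise it would be a finite set), and its tail is again dense.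
\<close>

definition transitive_map :: "real set \<Rightarrow> (real \<Rightarrow> real) \<Rightarrow> bool" where
  "transitive_map I f \<longleftrightarrow> (\<exists>x\<in>I. I \<subseteq> closure (range (\<lambda>n. (f ^^ n) x)))"

definition piecewise_affine :: "real set \<Rightarrow> (real \<Rightarrow> real) \<Rightarrow> bool" where
  "piecewise_affine I g \<longleftrightarrow>
     (\<exists>P. P division_of I \<and>
        (\<forall>J\<in>P. nd_interval J \<and> (\<exists>m q. \<forall>x\<in>interior J. g x = m * x + q)))"

definition CS :: "real \<Rightarrow> (real \<Rightarrow> real) set" where
  "CS \<beta> = {g. pcpm {0..1} g \<and> piecewise_affine {0..1} g \<and>
     (\<forall>x\<in>{0..1}. \<forall>D. (g has_real_derivative D) (at x within {0..1}) \<longrightarrow> \<bar>D\<bar> = \<beta>)}"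

definition conjugate_via ::
    "real set \<Rightarrow> (real \<Rightarrow> real) \<Rightarrow> (real \<Rightarrow> real) \<Rightarrow> (real \<Rightarrow> real) \<Rightarrow> bool" where
  "conjugate_via I \<psi> f g \<longleftrightarrow>
     (\<forall>J\<in>laps I f. \<forall>x\<in>J. \<psi> (branch f J x) = branch g (\<psi> ` J) (\<psi> x))"

end

theory Submission
  imports Defs
begin

text \<open>
  Following Milnor and Thurston, let \<open>c\<^sub>n(K)\<close> count the branches of \<open>f\<^sup>n\<close> that meet an interval \<open>K\<close>
  in more than a point, and let \<open>L(K,t)\<close> be the power series with coefficients \<open>c\<^sub>n(K)\<close>. For
  \<open>K = I\<close> its radius of convergence is \<open>1/\<beta>\<close>, where it diverges by submultiplicativity. Let \<open>\<psi>(x)\<close>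
  be a limit point of \<open>L([a,x],t) / L(I,t)\<close> as \<open>t\<close> increases to \<open>1/\<beta>\<close>; Tychonoff's theorem provides it
  for all \<open>x\<close> at once. Inside a lap \<open>J\<close> one has \<open>c\<^sub>n\<^sub>+\<^sub>1(K) = c\<^sub>n(f\<^sub>J(K))\<close>, hence
  \<open>L(K,t) = 1 + t L(f\<^sub>J(K),t)\<close>, and so the measure \<open>d\<psi>\<close> is stretched by \<open>\<beta>\<close> on each lap. Consequently it has
  no atoms, and transitivity excludes intervals of measure zero. Thus \<open>\<psi>\<close> is a homeomorphism, and it
  conjugates \<open>f\<close> to a map of constant slope.
\<close>

section \<open>Laps\<close>

text \<open>Branches are encoded by words of laps, and \<open>count\<close> counts words rather than
  laps of the iterate: deleting the first letter gives the exact equation behind \<open>L\<close>,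
  whereas adjacent branches of an iterate may fit together into one lap, so lap numbers need not
  satisfy it. The entropy speaks of laps, so the two counts have to be compared: the lap number is
  at most the word count, and one more letter adds at most (laps of the iterate) times (laps of
  \<open>f\<close>) words. Cutting an interval changes each coefficient by at most 1, so
  \<open>L\<close> is additive up to a bounded error; as \<open>L(I,t)\<close> is unbounded near
  \<open>1/\<beta>\<close>, dividing by it removes this error together with the constant term 1 of
  the functional equation. Transitivity enters twice: it rules out intervals of constancy of
  \<open>f\<close>, where maximal intervals could overlap and branches would not be injective, and
  it rules out flat pieces of \<open>\<psi>\<close>. For the latter, forward images of an interval
  are awkward, because discontinuities tear them apart; the orbit of a single point is followed
  instead.\<close>

definition nowhere_constant_on :: "real set \<Rightarrow> (real \<Rightarrow> real) \<Rightarrow> bool" where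
  "nowhere_constant_on I h \<longleftrightarrow>
     (\<forall>c d. c < d \<longrightarrow> {c..d} \<subseteq> I \<longrightarrow> (\<exists>x\<in>{c..d}. \<exists>y\<in>{c..d}. h x \<noteq> h y))"

lemma nd_intervalE:
  assumes "nd_interval J"
  obtains c d where "c < d" "J = {c..d}" "interior J = {c<..<d}"
  using assms unfolding nd_interval_def by (auto simp: interior_atLeastAtMost_real)

lemma cm_intervalE:
  assumes "cm_interval I f J"
  obtains c d where "c < d" "J = {c..d}" "interior J = {c<..<d}" "J \<subseteq> I"
    "cont_monotone_on {c<..<d} f"
  using assms unfolding cm_interval_def by (metis nd_intervalE)

lemma max_cmD: "M \<in> max_cm_intervals I f \<Longrightarrow> cm_interval I f M"
  by (simp add: max_cm_intervals_def)

lemma cont_monotone_on_subset: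
  "cont_monotone_on T f \<Longrightarrow> S \<subseteq> T \<Longrightarrow> cont_monotone_on S f"
  unfolding cont_monotone_on_def by (meson continuous_on_subset monotone_on_subset)

lemma cont_monotone_on_cong:
  "(\<And>x. x \<in> S \<Longrightarrow> f x = g x) \<Longrightarrow> cont_monotone_on S f \<longleftrightarrow> cont_monotone_on S g"
  unfolding cont_monotone_on_def monotone_on_def by (simp cong: continuous_on_cong)

lemma cont_inj_iff_cont_strict:
  fixes f :: "real \<Rightarrow> real"
  assumes "is_interval S" "continuous_on S f"
  shows "inj_on f S \<longleftrightarrow> strict_mono_on S f \<or> strict_antimono_on S f"
  using injective_eq_monotone_map[OF assms] .

lemma cont_inj_imp_cont_monotone:
  fixes f :: "real \<Rightarrow> real"
  assumes "is_interval S" "continuous_on S f" "inj_on f S"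
  shows "cont_monotone_on S f"
  using cont_inj_iff_cont_strict[OF assms(1,2)] assms
  unfolding cont_monotone_on_def by (auto simp: strict_mono_iff_mono strict_antimono_iff_antimono)

text \<open>Comparisons across the two intervals pass through the common point \<open>z\<close>; if
  \<open>z\<close> is not between the two points, one interval contains both.\<close>

lemma mono_on_union:
  fixes f :: "real \<Rightarrow> real"
  assumes "mono_on S f" "mono_on T f" "is_interval S" "is_interval T" "z \<in> S" "z \<in> T"
  shows "mono_on (S \<union> T) f"
proof -
  have main: "f x \<le> f y" if "x \<in> U" "y \<in> V" "x \<le> y" "mono_on U f" "mono_on V f"
    "is_interval U" "is_interval V" "z \<in> U" "z \<in> V" for x y U V
  proof -
    consider "x \<le> z" "z \<le> y" | "z < x" | "y < z" by linarith
    then show ?thesis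
    proof cases
      case 1 then show ?thesis
        using that by (meson mono_onD order_trans)
    next
      case 2
      then have "x \<in> V" using that by (meson is_interval_1 less_imp_le)
      then show ?thesis using that by (meson mono_onD)
    next
      case 3
      then have "y \<in> U" using that by (meson is_interval_1 less_imp_le)
      then show ?thesis using that by (meson mono_onD)
    qed
  qed
  show ?thesis
  proof (rule mono_onI)
    fix r s assume "r \<in> S \<union> T" "s \<in> S \<union> T" "r \<le> s"
    then show "f r \<le> f s"
      using main[of r S s T] main[of r T s S] assms by (auto dest: mono_onD)
  qed
qed

lemma antimono_on_union:
  fixes f :: "real \<Rightarrow> real"
  assumes "antimono_on S f" "antimono_on T f" "is_interval S" "is_interval T" "z \<in> S" "z \<in> T"
  shows "antimono_on (S \<union> T) f"
proof -
  have "mono_on (S \<union> T) (\<lambda>x. - f x)"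
    by (rule mono_on_union) (use assms in \<open>auto simp: monotone_on_def\<close>)
  then show ?thesis by (auto simp: monotone_on_def)
qed

text \<open>A monotone map taking the same value twice is constant in between, which is
  excluded.\<close>

lemma cm_interval_inj:
  assumes "nowhere_constant_on I h" "cm_interval I h J"
  shows "inj_on h (interior J)"
proof (rule ccontr)
  assume "\<not> inj_on h (interior J)"
  then obtain x y where xy: "x \<in> interior J" "y \<in> interior J" "x < y" "h x = h y"
    unfolding inj_on_def by (metis linorder_neqE_linordered_idom)
  obtain c d where cd: "c < d" "J = {c..d}" "interior J = {c<..<d}"
    using assms(2) nd_intervalE unfolding cm_interval_def by blast
  have sub: "{x..y} \<subseteq> interior J" using xy cd by auto
  have "h z = h x" if "z \<in> {x..y}" for z
  proof -
    have z: "z \<in> interior J" "x \<le> z" "z \<le> y" using that sub by auto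
    consider "mono_on (interior J) h" | "antimono_on (interior J) h"
      using assms(2) unfolding cm_interval_def cont_monotone_on_def by blast
    then show ?thesis
    proof cases
      case 1 then show ?thesis using z xy mono_onD[OF 1] by (metis order_antisym)
    next
      case 2 then show ?thesis using z xy by (metis order_antisym monotone_onD)
    qed
  qed
  moreover have "{x..y} \<subseteq> I"
    using sub interior_subset assms(2) unfolding cm_interval_def by blast
  ultimately show False
    using assms(1) xy(3) unfolding nowhere_constant_on_def by metis
qed

lemma is_interval_interior_nd:
  assumes "nd_interval J" shows "is_interval (interior J)"
proof -
  obtain c d where "interior J = {c<..<d}" using nd_intervalE[OF assms] by blast
  then show ?thesis by (auto simp: is_interval_1)
qed

text \<open>The overlap contains two points with different values, and these force the same
  direction of monotonicity on both intervals.\<close>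

lemma cm_interval_union:
  assumes nc: "nowhere_constant_on I h" and J: "cm_interval I h J" and K: "cm_interval I h K"
    and ne: "interior J \<inter> interior K \<noteq> {}"
  shows "cm_interval I h (J \<union> K)" "interior (J \<union> K) = interior J \<union> interior K"
proof -
  obtain c d where cd: "c < d" "J = {c..d}" "interior J = {c<..<d}"
    using J nd_intervalE unfolding cm_interval_def by blast
  obtain c' d' where cd': "c' < d'" "K = {c'..d'}" "interior K = {c'<..<d'}"
    using K nd_intervalE unfolding cm_interval_def by blast
  have ov: "max c c' < min d d'" using ne cd cd' by auto
  have U: "J \<union> K = {min c c'..max d d'}" using ov cd cd' by auto
  have "interior (J \<union> K) = {min c c'<..<max d d'}"
    unfolding U by (simp add: interior_atLeastAtMost_real)
  also have "\<dots> = interior J \<union> interior K" using ov cd cd' by auto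
  finally show int: "interior (J \<union> K) = interior J \<union> interior K" .
  obtain x where x: "max c c' < x" "x < min d d'" using dense ov by blast
  obtain y where y: "x < y" "y < min d d'" using dense x by blast
  have mem: "x \<in> interior J" "x \<in> interior K" "y \<in> interior J" "y \<in> interior K"
    using x y cd cd' by auto
  have neq: "h x \<noteq> h y"
    using cm_interval_inj[OF nc J] mem y(1) unfolding inj_on_def by force
  have iv: "is_interval (interior J)" "is_interval (interior K)"
    using J K is_interval_interior_nd unfolding cm_interval_def by auto
  have dir: "mono_on (interior J) h \<or> antimono_on (interior J) h"
    "mono_on (interior K) h \<or> antimono_on (interior K) h"
    using J K unfolding cm_interval_def cont_monotone_on_def by auto
  have 1: "h x \<le> h y" if "mono_on S h" "x \<in> S" "y \<in> S" for S
    using that y(1) by (meson mono_onD less_imp_le)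
  have 2: "h y \<le> h x" if "antimono_on S h" "x \<in> S" "y \<in> S" for S
    using that y(1) by (meson monotone_onD less_imp_le)
  have "mono_on (interior J) h \<and> mono_on (interior K) h
      \<or> antimono_on (interior J) h \<and> antimono_on (interior K) h"
    using dir 1 2 mem neq by (meson order_antisym)
  then have "mono_on (interior (J \<union> K)) h \<or> antimono_on (interior (J \<union> K)) h"
    unfolding int using mono_on_union antimono_on_union iv mem by metis
  moreover have "continuous_on (interior (J \<union> K)) h"
    unfolding int using J K
    by (intro continuous_on_open_Un) (auto simp: cm_interval_def cont_monotone_on_def)
  moreover have "nd_interval (J \<union> K)"
    unfolding U nd_interval_def using ov by (intro exI[of _ "min c c'"] exI[of _ "max d d'"] conjI refl) auto
  ultimately show "cm_interval I h (J \<union> K)"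
    using J K unfolding cm_interval_def cont_monotone_on_def by auto
qed

text \<open>The maximal interval is the hull of all members of \<open>C\<close>. This family is
  closed under unions, so it is directed. Its members need not reach the ends of the hull, but only
  interiors are tested.\<close>

lemma cm_interval_extend:
  assumes nc: "nowhere_constant_on {a..b} h" and J: "cm_interval {a..b} h J"
  shows "\<exists>M\<in>max_cm_intervals {a..b} h. J \<subseteq> M"
proof -
  define C where "C = {K. cm_interval {a..b} h K \<and> J \<subseteq> K}"
  have JC: "J \<in> C" using J by (simp add: C_def)
  have C_nd: "\<exists>c d. c < d \<and> K = {c..d} \<and> interior K = {c<..<d} \<and> a \<le> c \<and> d \<le> b" if "K \<in> C" for K
  proof -
    have K: "nd_interval K" "K \<subseteq> {a..b}" using that by (auto simp: C_def cm_interval_def)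
    obtain c d where "c < d" "K = {c..d}" "interior K = {c<..<d}"
      using K(1) by (rule nd_intervalE)
    then show ?thesis using K(2) by (intro exI[of _ c] exI[of _ d]) auto
  qed
  have C_ne: "interior J \<noteq> {}" using C_nd[OF JC] by auto
  have C_un: "K \<union> L \<in> C" if "K \<in> C" "L \<in> C" for K L
  proof -
    have "interior J \<subseteq> interior K \<inter> interior L"
      using that interior_mono unfolding C_def by blast
    then have "interior K \<inter> interior L \<noteq> {}" using C_ne by blast
    then show ?thesis using cm_interval_union(1)[OF nc] that by (auto simp: C_def)
  qed
  define c where "c = Inf (Inf ` C)"
  define d where "d = Sup (Sup ` C)"
  have C_ab: "a \<le> Inf K" "Sup K \<le> b" if "K \<in> C" for K
    using C_nd[OF that] by auto
  have bdd: "bdd_below (Inf ` C)" "bdd_above (Sup ` C)"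
    using C_ab by (auto intro!: bdd_belowI2[of _ a] bdd_aboveI2[of _ _ b])
  have sub: "K \<subseteq> {c..d}" if K: "K \<in> C" for K
  proof -
    obtain u v where uv: "u < v" "K = {u..v}" using C_nd[OF K] by blast
    have "c \<le> Inf K" "Sup K \<le> d"
      unfolding c_def d_def using bdd K by (auto intro: cInf_lower cSup_upper)
    then show ?thesis using uv by auto
  qed
  have cdab: "a \<le> c" "d \<le> b"
    unfolding c_def d_def using JC C_ab by (auto intro!: cINF_greatest cSUP_least)
  have "c < d" using sub[OF JC] C_nd[OF JC] by auto
  have int: "interior {c..d} = {c<..<d}" by (simp add: interior_atLeastAtMost_real)
  have cov1: "\<exists>K\<in>C. x \<in> interior K" if "x \<in> interior {c..d}" for x
  proof -
    have "c < x" "x < d" using that int by auto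
    then obtain K L where KL: "K \<in> C" "L \<in> C" "Inf K < x" "x < Sup L"
      unfolding c_def d_def
      using cInf_lessD[of "Inf ` C" x] less_cSupD[of "Sup ` C" x] JC by auto
    have UC: "K \<union> L \<in> C" using C_un KL by blast
    obtain u v where uv: "u < v" "K \<union> L = {u..v}" "interior (K \<union> L) = {u<..<v}"
      using C_nd[OF UC] by blast
    obtain u1 v1 where uv1: "u1 < v1" "K = {u1..v1}" using C_nd[OF KL(1)] by blast
    obtain u2 v2 where uv2: "u2 < v2" "L = {u2..v2}" using C_nd[OF KL(2)] by blast
    have "u \<le> u1" "v2 \<le> v"
    proof -
      have "u1 \<in> K \<union> L" "v2 \<in> K \<union> L" using uv1 uv2 by auto
      then show "u \<le> u1" "v2 \<le> v" unfolding uv(2) by auto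
    qed
    then have "x \<in> interior (K \<union> L)" using KL uv uv1 uv2 by auto
    then show ?thesis using UC by blast
  qed
  have cov2: "\<exists>K\<in>C. x \<in> interior K \<and> y \<in> interior K"
    if xy: "x \<in> interior {c..d}" "y \<in> interior {c..d}" for x y
  proof -
    obtain K L where "K \<in> C" "x \<in> interior K" "L \<in> C" "y \<in> interior L"
      using cov1[OF xy(1)] cov1[OF xy(2)] by blast
    then show ?thesis
      using C_un[of K L] interior_mono[of K "K \<union> L"] interior_mono[of L "K \<union> L"] by blast
  qed
  have Un: "interior {c..d} = (\<Union>K\<in>C. interior K)"
  proof
    show "interior {c..d} \<subseteq> (\<Union>K\<in>C. interior K)" using cov1 by auto
    show "(\<Union>K\<in>C. interior K) \<subseteq> interior {c..d}"
      using interior_mono[OF sub] by (rule UN_least)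
  qed
  have "continuous_on (interior {c..d}) h"
    unfolding Un by (rule continuous_on_open_UN)
      (auto simp: C_def cm_interval_def cont_monotone_on_def)
  \<comment> \<open>Injectivity concerns pairs of points, and any two points lie in one member;
    together with continuity it returns monotonicity without comparing directions.\<close>
  moreover have "inj_on h (interior {c..d})"
  proof (rule inj_onI)
    fix x y assume xy: "x \<in> interior {c..d}" "y \<in> interior {c..d}" "h x = h y"
    then obtain K where K: "K \<in> C" "x \<in> interior K" "y \<in> interior K" using cov2 by blast
    then show "x = y" using cm_interval_inj[OF nc, of K] xy(3) by (auto simp: C_def inj_on_def)
  qed
  ultimately have "cont_monotone_on (interior {c..d}) h"
    by (intro cont_inj_imp_cont_monotone) (auto simp: int is_interval_1)
  then have M: "cm_interval {a..b} h {c..d}"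
    using \<open>c < d\<close> cdab by (auto simp: cm_interval_def nd_interval_def)
  have "K = {c..d}" if "cm_interval {a..b} h K" "{c..d} \<subseteq> K" for K
  proof -
    have "K \<in> C" using that sub[OF JC] by (auto simp: C_def)
    then show ?thesis using sub that by blast
  qed
  then have "{c..d} \<in> max_cm_intervals {a..b} h"
    using M by (simp add: max_cm_intervals_def)
  then show ?thesis using sub[OF JC] by blast
qed

lemma max_cm_disjoint:
  assumes "nowhere_constant_on I h" "M \<in> max_cm_intervals I h" "K \<in> max_cm_intervals I h"
    "interior M \<inter> interior K \<noteq> {}"
  shows "M = K"
proof -
  have "cm_interval I h (M \<union> K)"
    using cm_interval_union(1)[OF assms(1)] assms(2-) by (simp add: max_cm_intervals_def)
  then show ?thesis
    using assms(2,3) unfolding max_cm_intervals_def by blast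
qed

text \<open>Without intervals of constancy maximal intervals never overlap, so none is shortened.\<close>

lemma laps_eq_max_cm:
  assumes nc: "nowhere_constant_on I h"
  shows "laps I h = max_cm_intervals I h"
proof -
  have "closure (M - \<Union>{M' \<in> max_cm_intervals I h. Inf M' < Inf M}) = M"
    if M: "M \<in> max_cm_intervals I h" for M
  proof -
    let ?U = "\<Union>{M' \<in> max_cm_intervals I h. Inf M' < Inf M}"
    obtain c d where cd: "c < d" "M = {c..d}" "interior M = {c<..<d}"
      using cm_intervalE[OF max_cmD[OF M]] by metis
    have "M' \<inter> {c<..<d} = {}" if M': "M' \<in> max_cm_intervals I h" "Inf M' < Inf M" for M'
    proof -
      obtain c' d' where cd': "c' < d'" "M' = {c'..d'}" "interior M' = {c'<..<d'}"
        using cm_intervalE[OF max_cmD[OF M'(1)]] by metis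
      have "interior M' \<inter> interior M = {}" using max_cm_disjoint[OF nc M'(1) M] M'(2) by auto
      then have "d' \<le> c" 
      proof -
        assume *: "interior M' \<inter> interior M = {}"
        have "c' < c" using M'(2) cd cd' by auto
        show ?thesis
        proof (rule ccontr)
          assume "\<not> d' \<le> c"
          then have "c < min d d'" using cd by auto
          then obtain x where "c < x" "x < min d d'" using dense by blast
          then have "x \<in> interior M' \<inter> interior M" using \<open>c' < c\<close> cd cd' by auto
          then show False using * by blast
        qed
      qed
      then show ?thesis using cd' by auto
    qed
    then have "{c<..<d} \<subseteq> M - ?U" using cd by auto
    then have "M \<subseteq> closure (M - ?U)"
      using closure_mono cd by (metis closure_greaterThanLessThan)
    moreover have "closure (M - ?U) \<subseteq> M" using cd by (intro closure_minimal) auto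
    ultimately show ?thesis by blast
  qed
  then show ?thesis unfolding laps_def by auto
qed

text \<open>A lap contains points besides the finitely many uncovered and boundary ones, so it
  overlaps some member of \<open>P\<close> and is the lap extending it. Applied to the division
  given by \<open>pcpm\<close> and to the cylinders of an iterate; \<open>m\<close> need not be
  injective.\<close>

lemma laps_from_cover:
  assumes nc: "nowhere_constant_on {a..b} h"
    and P: "finite P" "\<And>J. J \<in> P \<Longrightarrow> cm_interval {a..b} h J" "finite ({a..b} - \<Union>P)"
  obtains m where "laps {a..b} h = m ` P" "\<And>J. J \<in> P \<Longrightarrow> J \<subseteq> m J"
proof -
  have "\<exists>M. M \<in> max_cm_intervals {a..b} h \<and> J \<subseteq> M" if "J \<in> P" for J
    using cm_interval_extend[OF nc] P(2) that by blast
  then obtain m where "\<forall>J\<in>P. m J \<in> max_cm_intervals {a..b} h \<and> J \<subseteq> m J"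
    using bchoice[of P "\<lambda>J M. M \<in> max_cm_intervals {a..b} h \<and> J \<subseteq> M"] by blast
  then have m: "\<And>J. J \<in> P \<Longrightarrow> m J \<in> max_cm_intervals {a..b} h"
    "\<And>J. J \<in> P \<Longrightarrow> J \<subseteq> m J" by blast+
  have "M \<in> m ` P" if M: "M \<in> max_cm_intervals {a..b} h" for M
  proof -
    obtain c d where cd: "c < d" "M = {c..d}" "interior M = {c<..<d}" "M \<subseteq> {a..b}"
      using cm_intervalE[OF max_cmD[OF M]] by metis
    define E where "E = ({a..b} - \<Union>P) \<union> (\<Union>J\<in>P. J - interior J)"
    have "finite (J - interior J)" if J: "J \<in> P" for J
    proof -
      obtain u v where uv: "u < v" "J = {u..v}" "interior J = {u<..<v}"
        using cm_intervalE[OF P(2)[OF J]] by metis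
      have "J - interior J \<subseteq> {u,v}" using uv by auto
      then show ?thesis using finite_subset by blast
    qed
    then have "finite E" using P by (auto simp: E_def)
    then have "infinite ({c<..<d} - E)" using cd(1) by (simp add: Diff_infinite_finite)
    then obtain x where x: "x \<in> {c<..<d}" "x \<notin> E" by (metis Diff_iff finite.emptyI equals0I)
    then obtain J where J: "J \<in> P" "x \<in> interior J" using cd by (auto simp: E_def)
    then have "x \<in> interior M \<inter> interior (m J)"
      using x cd m(2)[OF J(1)] interior_mono by blast
    then have "M = m J" using max_cm_disjoint[OF nc M m(1)[OF J(1)]] by blast
    then show ?thesis using J by blast
  qed
  then have "laps {a..b} h = m ` P" using m(1) laps_eq_max_cm[OF nc] by auto
  then show ?thesis using that m(2) by blast
qed

lemma laps_division:
  assumes nc: "nowhere_constant_on {a..b} h" and h: "pcpm {a..b} h"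
  shows "laps {a..b} h division_of {a..b}"
    and "\<And>J. J \<in> laps {a..b} h \<Longrightarrow> cm_interval {a..b} h J"
proof -
  obtain P where P: "P division_of {a..b}"
    "\<And>J. J\<in>P \<Longrightarrow> nd_interval J \<and> cont_monotone_on (interior J) h"
    using h unfolding pcpm_def by auto
  have fin: "finite P" and un: "\<Union>P = {a..b}" using P(1) by (auto simp: division_of_def)
  have Pcm: "cm_interval {a..b} h J" if "J \<in> P" for J
    using that P(2) un unfolding cm_interval_def by blast
  have "finite ({a..b} - \<Union>P)" by (simp add: un)
  then obtain m where m: "laps {a..b} h = m ` P" "\<And>J. J \<in> P \<Longrightarrow> J \<subseteq> m J"
    using laps_from_cover[OF nc fin Pcm] by metis
  show cm: "cm_interval {a..b} h J" if "J \<in> laps {a..b} h" for J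
    using that unfolding laps_eq_max_cm[OF nc] max_cm_intervals_def by blast
  show "laps {a..b} h division_of {a..b}"
  proof (rule division_ofI)
    show "finite (laps {a..b} h)" using m fin by simp
    show "K \<subseteq> {a..b}" if "K \<in> laps {a..b} h" for K
      using cm[OF that] by (simp add: cm_interval_def)
    show "K \<noteq> {}" "\<exists>a b. K = cbox a b" if "K \<in> laps {a..b} h" for K
      using cm[OF that] unfolding cm_interval_def nd_interval_def cbox_interval by auto
    show "interior K1 \<inter> interior K2 = {}"
      if "K1 \<in> laps {a..b} h" "K2 \<in> laps {a..b} h" "K1 \<noteq> K2" for K1 K2
      using max_cm_disjoint[OF nc] that unfolding laps_eq_max_cm[OF nc] by blast
    have "\<Union>P \<subseteq> \<Union>(laps {a..b} h)" unfolding m(1) using m(2) by blast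
    then show "\<Union>(laps {a..b} h) = {a..b}"
      using un cm unfolding cm_interval_def by blast
  qed
qed

section \<open>Cylinders and lap counts\<close>

text \<open>In this form, without asking for interior, the property is transported by injective maps
  with no continuity needed. For intervals it amounts to nonempty interior.\<close>

definition nontrivial :: "real set \<Rightarrow> bool" where
  "nontrivial S \<longleftrightarrow> (\<exists>x\<in>S. \<exists>y\<in>S. x < y)"

lemma nontrivial_iff: "nontrivial S \<longleftrightarrow> (\<exists>x\<in>S. \<exists>y\<in>S. x \<noteq> y)"
  unfolding nontrivial_def by (metis linorder_neqE_linordered_idom less_irrefl)

lemma nontrivial_mono: "nontrivial S \<Longrightarrow> S \<subseteq> T \<Longrightarrow> nontrivial T"
  unfolding nontrivial_def by blast

lemma nontrivial_inj_image: "inj_on f S \<Longrightarrow> nontrivial (f ` S) \<longleftrightarrow> nontrivial S"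
  by (simp add: nontrivial_iff inj_on_eq_iff cong: bex_cong)

lemma nontrivial_Icc [simp]: "nontrivial {c..d} \<longleftrightarrow> c < d"
  unfolding nontrivial_def by force

lemma finite_if_not_nontrivial:
  assumes "\<not> nontrivial S" shows "finite S"
proof (cases "S = {}")
  case False
  then obtain x where "x \<in> S" by blast
  then have "S = {x}" using assms unfolding nontrivial_iff by blast
  then show ?thesis by simp
qed simp

lemma nontrivial_interval:
  fixes a b :: real
  assumes "nontrivial S" "is_interval S" "closed S" "S \<subseteq> {a..b}"
  obtains c d where "c < d" "S = {c..d}" "interior S = {c<..<d}"
proof -
  have "compact S" using assms by (meson bounded_closed_interval bounded_subset compact_eq_bounded_closed)
  then obtain c d where cd: "S = {c..d}"
    using assms(2) by (metis connected_compact_interval_1 is_interval_connected_1)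
  then have "c < d" using assms(1) by simp
  then show ?thesis using that cd by (simp add: interior_atLeastAtMost_real)
qed

lemma nontrivial_if_interior:
  assumes "interior S \<noteq> {}" shows "nontrivial S"
proof -
  obtain x where "x \<in> interior S" using assms by blast
  then obtain e where e: "e > 0" "cball x e \<subseteq> S" using mem_interior_cball by metis
  have "x \<in> cball x e" "x + e \<in> cball x e" using e(1) by (auto simp: dist_real_def)
  then have "x \<in> S" "x + e \<in> S" "x < x + e" using e by auto
  then show ?thesis unfolding nontrivial_def by blast
qed

lemma is_interval_Icc_subset:
  fixes S :: "real set"
  assumes "is_interval S" "x \<in> S" "y \<in> S" shows "{x..y} \<subseteq> S"
proof
  fix z assume "z \<in> {x..y}"
  then show "z \<in> S" using assms unfolding is_interval_1 by (meson atLeastAtMost_iff)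
qed

lemma interior_if_nontrivial_interval:
  assumes "nontrivial S" "is_interval S" shows "interior S \<noteq> {}"
proof -
  obtain x y where xy: "x \<in> S" "y \<in> S" "x < y" using assms(1) by (auto simp: nontrivial_def)
  then have "{x..y} \<subseteq> S" using assms(2) by (intro is_interval_Icc_subset)
  then have "{x<..<y} \<subseteq> interior S"
    using interior_mono[of "{x..y}" S] by (simp add: interior_atLeastAtMost_real)
  moreover have "(x + y) / 2 \<in> {x<..<y}" using xy(3) by simp
  ultimately show ?thesis by blast
qed

text \<open>By strict monotonicity endpoints go to endpoints of the image, so a point over the
  interior is not an endpoint.\<close>

lemma mem_interior_of_image:
  fixes \<phi> :: "real \<Rightarrow> real"
  assumes "continuous_on {c..d} \<phi>" "inj_on \<phi> {c..d}" "y \<in> {c..d}"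
    "\<phi> y \<in> interior (\<phi> ` {c..d})"
  shows "y \<in> {c<..<d}"
proof -
  have "is_interval {c..d}" by (simp add: is_interval_cc)
  then consider "strict_mono_on {c..d} \<phi>" | "strict_antimono_on {c..d} \<phi>"
    using cont_inj_iff_cont_strict[of "{c..d}" \<phi>] assms by blast
  then show ?thesis
  proof cases
    case 1
    then have "\<phi> ` {c..d} \<subseteq> {\<phi> c..\<phi> d}"
      using assms(3) by (auto simp: strict_mono_iff_mono intro!: mono_onD[of "{c..d}" \<phi>])
    then have "\<phi> y \<in> {\<phi> c<..<\<phi> d}"
      using assms(4) interior_mono interior_atLeastAtMost_real by blast
    then show ?thesis using assms(3) by (cases "y = c"; cases "y = d"; auto)
  next
    case 2
    then have "\<phi> ` {c..d} \<subseteq> {\<phi> d..\<phi> c}"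
      using assms(3) by (auto simp: strict_antimono_iff_antimono intro!: monotone_onD[of "{c..d}" "(\<le>)" "(\<ge>)" \<phi>])
    then have "\<phi> y \<in> {\<phi> d<..<\<phi> c}"
      using assms(4) interior_mono interior_atLeastAtMost_real by blast
    then show ?thesis using assms(3) by (cases "y = c"; cases "y = d"; auto)
  qed
qed

text \<open>The pointwise map is forgotten: only finitely many closed pieces remain, with continuous
  injective maps on them. With \<open>laps {a..b} f\<close> and \<open>branch f\<close> as instance,
  the arbitrary values of \<open>f\<close> at lap endpoints never enter.\<close>

locale lap_system =
  fixes a b :: real and D :: "real set set" and F :: "real set \<Rightarrow> real \<Rightarrow> real"
  assumes ab: "a < b"
    and fin_D: "finite D"
    and cover: "\<Union>D = {a..b}"
    and nd_D: "J \<in> D \<Longrightarrow> nd_interval J"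
    and disj_D: "J \<in> D \<Longrightarrow> J' \<in> D \<Longrightarrow> J \<noteq> J' \<Longrightarrow> \<not> nontrivial (J \<inter> J')"
    and cont_F: "J \<in> D \<Longrightarrow> continuous_on J (F J)"
    and inj_F: "J \<in> D \<Longrightarrow> inj_on (F J) J"
    and maps_F: "J \<in> D \<Longrightarrow> F J ` J \<subseteq> {a..b}"
begin

text \<open>The points that can follow the itinerary \<open>w\<close>, whose first letter is visited
  first. The pieces are closed, so neighbouring cylinders can share endpoints; counting therefore
  asks for more than one point.\<close>

primrec cyl :: "real set list \<Rightarrow> real set" where
  "cyl [] = {a..b}"
| "cyl (J # w) = J \<inter> F J -` cyl w"

primrec along :: "real set list \<Rightarrow> real \<Rightarrow> real" where
  "along [] x = x"
| "along (J # w) x = along w (F J x)"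

definition words :: "nat \<Rightarrow> real set list set" where
  "words n = {w. length w = n \<and> set w \<subseteq> D}"

definition admissible :: "nat \<Rightarrow> real set list set" where
  "admissible n = {w \<in> words n. nontrivial (cyl w)}"

definition count :: "nat \<Rightarrow> real set \<Rightarrow> nat" where
  "count n K = card {w \<in> words n. nontrivial (K \<inter> cyl w)}"

abbreviation total :: "nat \<Rightarrow> nat" where
  "total n \<equiv> count n {a..b}"

lemma D_sub: "J \<in> D \<Longrightarrow> J \<subseteq> {a..b}"
  using cover by blast

lemma D_Icc:
  assumes "J \<in> D"
  obtains c d where "c < d" "J = {c..d}" "a \<le> c" "d \<le> b"
proof -
  obtain c d where "c < d" "J = {c..d}" using nd_intervalE[OF nd_D[OF assms]] by metis
  then show ?thesis using that[of c d] D_sub[OF assms] by simp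
qed

lemma strict_F: "J \<in> D \<Longrightarrow> strict_mono_on J (F J) \<or> strict_antimono_on J (F J)"
  using cont_inj_iff_cont_strict[OF _ cont_F] inj_F D_Icc by (metis is_interval_cc)

lemma finite_words [simp]: "finite (words n)"
  unfolding words_def using finite_lists_length_eq[OF fin_D] by (simp add: conj_commute)

lemma words_0: "words 0 = {[]}" by (auto simp: words_def)

lemma finite_admissible [simp]: "finite (admissible n)"
  by (simp add: admissible_def)

lemma Cons_words: "J # w \<in> words (Suc n) \<longleftrightarrow> J \<in> D \<and> w \<in> words n"
  by (auto simp: words_def)

lemma words_SucE:
  assumes "w \<in> words (Suc n)"
  obtains J v where "w = J # v" "J \<in> D" "v \<in> words n"
  using assms by (cases w) (auto simp: words_def)

text \<open>Each \<open>F J\<close> preserves betweenness up to reversal, so preimages of intervals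
  within a piece are intervals; they are closed by continuity on a closed piece.\<close>

lemma cyl_closed_interval:
  "set w \<subseteq> D \<Longrightarrow> closed (cyl w) \<and> is_interval (cyl w) \<and> cyl w \<subseteq> {a..b}"
proof (induction w)
  case Nil then show ?case by (simp add: is_interval_cc)
next
  case (Cons J w)
  then have J: "J \<in> D" and IH: "closed (cyl w)" "is_interval (cyl w)" by auto
  obtain c d where cd: "J = {c..d}" using D_Icc[OF J] by metis
  have "closed (cyl (J # w))"
    using continuous_closed_preimage[OF cont_F[OF J] _ IH(1)] cd by simp
  moreover have "is_interval (cyl (J # w))"
    unfolding is_interval_1
  proof (intro ballI allI impI)
    fix x y z assume xy: "x \<in> cyl (J # w)" "y \<in> cyl (J # w)" "x \<le> z \<and> z \<le> y"
    then have z: "z \<in> J" and xyJ: "x \<in> J" "y \<in> J" using cd by auto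
    have "F J x \<le> F J z \<and> F J z \<le> F J y \<or> F J y \<le> F J z \<and> F J z \<le> F J x"
      using strict_F[OF J] z xyJ xy(3)
      by (auto simp: monotone_on_def less_eq_real_def)
    then have "F J z \<in> cyl w"
      using IH(2) xy(1,2) unfolding is_interval_1 by auto
    then show "z \<in> cyl (J # w)" using z by simp
  qed
  moreover have "cyl (J # w) \<subseteq> {a..b}" using D_sub[OF J] by auto
  ultimately show ?case by blast
qed

lemma words_cyl:
  assumes "w \<in> words n"
  shows "closed (cyl w)" "is_interval (cyl w)" "cyl w \<subseteq> {a..b}"
  using cyl_closed_interval assms by (auto simp: words_def)

lemma admissible_Icc:
  assumes "w \<in> admissible n"
  obtains c d where "c < d" "cyl w = {c..d}" "interior (cyl w) = {c<..<d}" "a \<le> c" "d \<le> b"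
proof -
  have w: "w \<in> words n" "nontrivial (cyl w)" using assms by (auto simp: admissible_def)
  obtain c d where "c < d" "cyl w = {c..d}" "interior (cyl w) = {c<..<d}"
    using nontrivial_interval[OF w(2) words_cyl(2,1,3)[OF w(1)]] by metis
  then show ?thesis using that[of c d] words_cyl(3)[OF w(1)] by simp
qed

lemma along_props:
  "set w \<subseteq> D \<Longrightarrow> continuous_on (cyl w) (along w) \<and> inj_on (along w) (cyl w)
     \<and> along w ` cyl w \<subseteq> {a..b}"
proof (induction w)
  case Nil
  have "along [] = (\<lambda>x. x)" by auto
  then show ?case by simp
next
  case (Cons J w)
  then have J: "J \<in> D" and IH: "continuous_on (cyl w) (along w)" "inj_on (along w) (cyl w)"
    "along w ` cyl w \<subseteq> {a..b}" by auto
  have eq: "along (J # w) = along w \<circ> F J" by auto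
  have sub: "cyl (J # w) \<subseteq> J" "F J ` cyl (J # w) \<subseteq> cyl w" by auto
  have "continuous_on (cyl (J # w)) (along (J # w))"
    unfolding eq using sub IH(1) cont_F[OF J] by (meson continuous_on_compose continuous_on_subset)
  moreover have "inj_on (along (J # w)) (cyl (J # w))"
    unfolding eq using sub IH(2) inj_F[OF J] by (meson comp_inj_on inj_on_subset)
  moreover have "along (J # w) ` cyl (J # w) \<subseteq> {a..b}"
    using IH(3) by auto
  ultimately show ?case by blast
qed

lemma words_along:
  assumes "w \<in> words n"
  shows "continuous_on (cyl w) (along w)" "inj_on (along w) (cyl w)" "along w ` cyl w \<subseteq> {a..b}"
  using along_props assms by (auto simp: words_def)

lemma along_append: "along (u @ v) x = along v (along u x)"
  by (induction u arbitrary: x) auto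

lemma cyl_append:
  assumes "set v \<subseteq> D"
  shows "cyl (u @ v) = cyl u \<inter> along u -` cyl v"
proof (induction u)
  case Nil
  have "cyl v \<subseteq> {a..b}" using cyl_closed_interval[OF assms] by blast
  then show ?case by auto
qed auto

text \<open>The first letters overlap, hence agree; the injective \<open>F J\<close> then carries
  the overlap to the remaining letters.\<close>

lemma cyl_disjoint:
  "w \<in> words n \<Longrightarrow> w' \<in> words n \<Longrightarrow> nontrivial (cyl w \<inter> cyl w') \<Longrightarrow> w = w'"
proof (induction n arbitrary: w w')
  case 0 then show ?case by (simp add: words_0)
next
  case (Suc n)
  obtain J v where w: "w = J # v" "J \<in> D" "v \<in> words n" using words_SucE Suc.prems(1) by metis
  obtain J' v' where w': "w' = J' # v'" "J' \<in> D" "v' \<in> words n" using words_SucE Suc.prems(2) by metis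
  have "nontrivial (J \<inter> J')"
    using Suc.prems(3) by (rule nontrivial_mono) (auto simp: w w')
  then have "J = J'" using disj_D w(2) w'(2) by metis
  have "inj_on (F J) (cyl w \<inter> cyl w')"
    by (rule inj_on_subset[OF inj_F[OF w(2)]]) (auto simp: w)
  then have "nontrivial (F J ` (cyl w \<inter> cyl w'))"
    using Suc.prems(3) by (simp add: nontrivial_inj_image)
  then have "nontrivial (cyl v \<inter> cyl v')"
    by (rule nontrivial_mono) (use w w' \<open>J = J'\<close> in auto)
  then show ?case using Suc.IH w w' \<open>J = J'\<close> by blast
qed

lemma cyl_cover: "x \<in> {a..b} \<Longrightarrow> \<exists>w\<in>words n. x \<in> cyl w"
proof (induction n arbitrary: x)
  case 0 then show ?case by (simp add: words_0)
next
  case (Suc n)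
  obtain J where J: "J \<in> D" "x \<in> J" using Suc.prems cover by blast
  then have "F J x \<in> {a..b}" using maps_F by blast
  then obtain w where "w \<in> words n" "F J x \<in> cyl w" using Suc.IH by blast
  then have "J # w \<in> words (Suc n)" "x \<in> cyl (J # w)" using J by (auto simp: Cons_words)
  then show ?case by blast
qed

text \<open>The words of length \<open>n\<close> cover the interval, and a cylinder that is not
  admissible has at most one point.\<close>

lemma finite_uncovered: "finite ({a..b} - (\<Union>w\<in>admissible n. cyl w))"
proof (rule finite_subset)
  show "{a..b} - (\<Union>w\<in>admissible n. cyl w) \<subseteq> (\<Union>w\<in>{w\<in>words n. \<not> nontrivial (cyl w)}. cyl w)"
    using cyl_cover by (fastforce simp: admissible_def)
  show "finite (\<Union>w\<in>{w\<in>words n. \<not> nontrivial (cyl w)}. cyl w)"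
    using finite_if_not_nontrivial by auto
qed

lemma total_eq: "total n = card (admissible n)"
proof -
  have "{w \<in> words n. nontrivial ({a..b} \<inter> cyl w)} = admissible n"
    using words_cyl(3) unfolding admissible_def by (metis (no_types, lifting) Int_absorb1)
  then show ?thesis by (simp add: count_def)
qed

lemma count_trivial: "\<not> nontrivial K \<Longrightarrow> count n K = 0"
proof -
  assume "\<not> nontrivial K"
  then have "{w \<in> words n. nontrivial (K \<inter> cyl w)} = {}"
    using nontrivial_mono by blast
  then show ?thesis unfolding count_def by (metis card.empty)
qed

lemma count_0: "nontrivial K \<Longrightarrow> K \<subseteq> {a..b} \<Longrightarrow> count 0 K = 1"
proof -
  assume "nontrivial K" "K \<subseteq> {a..b}"
  then have "{w \<in> words 0. nontrivial (K \<inter> cyl w)} = {[]}"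
    by (auto simp: words_0 Int_absorb2)
  then show ?thesis by (simp add: count_def)
qed

text \<open>An itinerary shared by more than one point of \<open>K\<close> must start with
  \<open>J\<close>, and deleting this letter is a bijection onto the itineraries seen in the
  image.\<close>

lemma count_Suc:
  assumes J: "J \<in> D" and K: "K \<subseteq> J"
  shows "count (Suc n) K = count n (F J ` K)"
proof -
  have *: "nontrivial (K \<inter> cyl (J # v)) \<longleftrightarrow> nontrivial (F J ` K \<inter> cyl v)" for v
  proof -
    have "F J ` (K \<inter> cyl (J # v)) = F J ` K \<inter> cyl v" using K by auto
    moreover have "inj_on (F J) (K \<inter> cyl (J # v))"
      by (rule inj_on_subset[OF inj_F[OF J]]) (use K in auto)
    ultimately show ?thesis using nontrivial_inj_image by metis
  qed
  have "{w \<in> words (Suc n). nontrivial (K \<inter> cyl w)}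
      = (#) J ` {v \<in> words n. nontrivial (F J ` K \<inter> cyl v)}" (is "?A = ?B")
  proof
    show "?A \<subseteq> ?B"
    proof
      fix w assume w: "w \<in> ?A"
      then obtain J' v where v: "w = J' # v" "J' \<in> D" "v \<in> words n" using words_SucE by blast
      have "nontrivial (J \<inter> J')"
        by (rule nontrivial_mono[of "K \<inter> cyl w"]) (use w v K in auto)
      then have "J' = J" using disj_D J v(2) by metis
      then show "w \<in> ?B" using w v * by auto
    qed
    show "?B \<subseteq> ?A" using * J by (auto simp: Cons_words simp del: cyl.simps)
  qed
  then show ?thesis unfolding count_def by (simp add: card_image)
qed

text \<open>The error 1 comes from a cylinder reaching across \<open>d\<close>, which is counted on
  both sides.\<close>

lemma count_split:
  assumes "c \<le> d" "d \<le> e"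
  shows "count n {c..e} \<le> count n {c..d} + count n {d..e}"
    and "count n {c..d} + count n {d..e} \<le> count n {c..e} + 1"
proof -
  let ?S = "\<lambda>K. {w \<in> words n. nontrivial (K \<inter> cyl w)}"
  have "?S {c..e} \<subseteq> ?S {c..d} \<union> ?S {d..e}"
  proof
    fix w assume "w \<in> ?S {c..e}"
    then obtain x y where w: "w \<in> words n" and xy: "x < y" "x \<in> cyl w" "y \<in> cyl w" "c \<le> x" "y \<le> e"
      by (auto simp: nontrivial_def)
    have "nontrivial ({c..d} \<inter> cyl w) \<or> nontrivial ({d..e} \<inter> cyl w)"
    proof (cases "x < d")
      case True
      define z where "z = min y d"
      have "{x..y} \<subseteq> cyl w" by (rule is_interval_Icc_subset) (use words_cyl(2)[OF w] xy in auto)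
      moreover have "z \<in> {x..y}" using xy True by (auto simp: z_def)
      ultimately have "z \<in> cyl w" by blast
      then have "x \<in> {c..d} \<inter> cyl w" "z \<in> {c..d} \<inter> cyl w" "x < z"
        using xy True assms by (auto simp: z_def)
      then show ?thesis unfolding nontrivial_def by blast
    next
      case False
      then have "x \<in> {d..e} \<inter> cyl w" "y \<in> {d..e} \<inter> cyl w" using xy by auto
      then show ?thesis using xy(1) unfolding nontrivial_def by blast
    qed
    then show "w \<in> ?S {c..d} \<union> ?S {d..e}" using w by simp
  qed
  then have "card (?S {c..e}) \<le> card (?S {c..d} \<union> ?S {d..e})"
    by (intro card_mono) auto
  also have "\<dots> \<le> card (?S {c..d}) + card (?S {d..e})" by (rule card_Un_le)
  finally show "count n {c..e} \<le> count n {c..d} + count n {d..e}" by (simp add: count_def)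
  \<comment> \<open>A word counted twice has points strictly on both sides of \<open>d\<close>; two
    such cylinders overlap around \<open>d\<close> and belong to the same word.\<close>
  have one: "w = w'" if ww: "w \<in> ?S {c..d} \<inter> ?S {d..e}" "w' \<in> ?S {c..d} \<inter> ?S {d..e}" for w w'
  proof -
    have *: "\<exists>x y. x < d \<and> d < y \<and> {x..y} \<subseteq> cyl v" if "v \<in> ?S {c..d} \<inter> ?S {d..e}" for v
    proof -
      have "nontrivial ({c..d} \<inter> cyl v)" "nontrivial ({d..e} \<inter> cyl v)" using that by simp_all
      then obtain x x' y' y where "x \<in> {c..d} \<inter> cyl v" "x' \<in> {c..d} \<inter> cyl v" "x < x'"
        "y' \<in> {d..e} \<inter> cyl v" "y \<in> {d..e} \<inter> cyl v" "y' < y"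
        unfolding nontrivial_def by metis
      then have "x < d" "d < y" "x \<in> cyl v" "y \<in> cyl v" by auto
      moreover from this have "{x..y} \<subseteq> cyl v"
        using is_interval_Icc_subset[of "cyl v" x y] words_cyl(2)[of v n] that by simp
      ultimately show ?thesis by blast
    qed
    obtain x y where xy: "x < d" "d < y" "{x..y} \<subseteq> cyl w" using *[OF ww(1)] by blast
    obtain x' y' where xy': "x' < d" "d < y'" "{x'..y'} \<subseteq> cyl w'" using *[OF ww(2)] by blast
    have "{max x x'..min y y'} \<subseteq> cyl w \<inter> cyl w'" using xy(3) xy'(3) by auto
    moreover have "nontrivial {max x x'..min y y'}" using xy xy' by simp
    ultimately have "nontrivial (cyl w \<inter> cyl w')" by (metis nontrivial_mono)
    then show ?thesis using cyl_disjoint[of w n w'] ww by simp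
  qed
  have "card (?S {c..d} \<inter> ?S {d..e}) \<le> Suc 0"
    using one by (subst card_le_Suc0_iff_eq) auto
  moreover have "card (?S {c..d} \<union> ?S {d..e}) \<le> card (?S {c..e})"
    using assms by (intro card_mono) (auto intro: nontrivial_mono)
  ultimately show "count n {c..d} + count n {d..e} \<le> count n {c..e} + 1"
    using card_Un_Int[of "?S {c..d}" "?S {d..e}"] by (simp add: count_def)
qed

section \<open>Cutting and prolonging words\<close>

lemma admissible_appendD:
  assumes w: "u @ v \<in> admissible (n + m)" and "length u = n"
  shows "u \<in> admissible n" "v \<in> admissible m"
proof -
  have words: "u \<in> words n" "v \<in> words m" using assms by (auto simp: admissible_def words_def)
  have nt: "nontrivial (cyl (u @ v))" using w by (simp add: admissible_def)
  have eq: "cyl (u @ v) = cyl u \<inter> along u -` cyl v"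
    using words(2) by (intro cyl_append) (simp add: words_def)
  show "u \<in> admissible n" using nt words eq nontrivial_mono by (auto simp: admissible_def)
  have "inj_on (along u) (cyl (u @ v))"
    by (rule inj_on_subset[OF words_along(2)[OF words(1)]]) (auto simp: eq)
  then have "nontrivial (along u ` cyl (u @ v))" using nt by (simp add: nontrivial_inj_image)
  then have "nontrivial (cyl v)" by (rule nontrivial_mono) (auto simp: eq)
  then show "v \<in> admissible m" using words by (simp add: admissible_def)
qed

lemma admissible_snocE:
  assumes w: "w \<in> admissible (Suc n)"
  obtains u J where "w = u @ [J]" "u \<in> admissible n" "J \<in> D" "nontrivial (along u ` cyl u \<inter> J)"
proof -
  have "length w = Suc n" "set w \<subseteq> D" using w by (auto simp: admissible_def words_def)
  then obtain u J where uJ: "w = u @ [J]" "length u = n" "J \<in> D" "set u \<subseteq> D"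
    by (metis append_butlast_last_id butlast.simps(1) in_set_butlastD last_in_set length_0_conv
        length_butlast diff_Suc_1 nat.distinct(1) subset_code(1))
  have u: "u \<in> admissible n" using admissible_appendD(1)[of u "[J]" n 1] w uJ by simp
  have eq: "cyl w = cyl u \<inter> along u -` (J \<inter> F J -` {a..b})"
    using cyl_append[of "[J]" u] uJ by simp
  have "inj_on (along u) (cyl w)"
    by (rule inj_on_subset[OF words_along(2)]) (use u eq in \<open>auto simp: admissible_def\<close>)
  then have "nontrivial (along u ` cyl w)"
    using w by (simp add: nontrivial_inj_image admissible_def)
  then have "nontrivial (along u ` cyl u \<inter> J)" by (rule nontrivial_mono) (auto simp: eq)
  then show ?thesis using that uJ u by blast
qed

text \<open>Cutting a word after \<open>n\<close> letters loses no information, and both parts are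
  admissible.\<close>

lemma total_submult: "total (n + m) \<le> total n * total m"
proof -
  have "card (admissible (n + m)) \<le> card (admissible n \<times> admissible m)"
  proof (rule card_inj_on_le[where f = "\<lambda>w. (take n w, drop n w)"])
    show "inj_on (\<lambda>w. (take n w, drop n w)) (admissible (n + m))"
      by (rule inj_onI) (metis append_take_drop_id prod.inject)
    show "(\<lambda>w. (take n w, drop n w)) ` admissible (n + m) \<subseteq> admissible n \<times> admissible m"
    proof clarify
      fix w assume w: "w \<in> admissible (n + m)"
      then have "length w = n + m" by (simp add: admissible_def words_def)
      then show "take n w \<in> admissible n \<and> drop n w \<in> admissible m"
        using admissible_appendD[of "take n w" "drop n w" n m] w by simp
    qed
  qed simp
  then show ?thesis by (simp add: total_eq card_cartesian_product)
qed

text \<open>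
  Prolonging an \<open>n\<close>-word creates a new word only where \<open>f\<^sup>n\<close> takes the value
  \<open>Inf J\<close> in the interior of a cylinder, which happens at most once per lap of \<open>f\<^sup>n\<close>.
\<close>

lemma total_Suc_le:
  assumes m: "\<And>w. w \<in> admissible n \<Longrightarrow> cyl w \<subseteq> m w"
    and h: "\<And>w x. w \<in> admissible n \<Longrightarrow> x \<in> interior (cyl w) \<Longrightarrow> h x = along w x"
    and inj: "\<And>w. w \<in> admissible n \<Longrightarrow> inj_on h (interior (m w))"
  shows "total (Suc n) \<le> total n + card (m ` admissible n) * card D"
proof -
  let ?T = "\<lambda>w. along w ` cyl w"
  define X where "X = {(w,J). w \<in> admissible n \<and> J \<in> D \<and> Inf J \<in> interior (?T w)}"
  have finX: "finite X"
    by (rule finite_subset[of _ "admissible n \<times> D"]) (auto simp: X_def fin_D)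
  have T_Icc: "\<exists>p q. p < q \<and> ?T w = {p..q} \<and> interior (?T w) = {p<..<q}" if w: "w \<in> admissible n" for w
  proof -
    have ww: "w \<in> words n" "nontrivial (cyl w)" using w by (auto simp: admissible_def)
    obtain c d where cd: "cyl w = {c..d}" using admissible_Icc[OF w] by metis
    have "nontrivial (?T w)" using ww by (simp add: words_along(2) nontrivial_inj_image)
    moreover have "compact (?T w)" "connected (?T w)"
      using words_along(1)[OF ww(1)] unfolding cd
      by (auto intro: compact_continuous_image connected_continuous_image)
    ultimately obtain p q where "p < q" "?T w = {p..q}"
      by (metis connected_compact_interval_1 nontrivial_Icc)
    then show ?thesis by (auto simp: interior_atLeastAtMost_real)
  qed
  \<comment> \<open>A word \<open>u @ [J]\<close> is coded by \<open>u\<close> alone if the left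
    endpoint of \<open>J\<close> is not interior to the image of \<open>cyl u\<close>, otherwise by
    the pair. For each \<open>u\<close> at most one \<open>J\<close> is of the first kind, the one
    covering the left end of the image.\<close>
  define g :: "real set list \<Rightarrow> real set list + real set list \<times> real set" where
    "g w = (if Inf (last w) \<in> interior (?T (butlast w)) then Inr (butlast w, last w)
            else Inl (butlast w))" for w
  have "card (admissible (Suc n)) \<le> card (admissible n <+> X)"
  proof (rule card_inj_on_le[where f = g])
    show "g ` admissible (Suc n) \<subseteq> admissible n <+> X"
    proof
      fix y assume "y \<in> g ` admissible (Suc n)"
      then obtain w where w: "w \<in> admissible (Suc n)" "y = g w" by blast
      obtain u J where "w = u @ [J]" "u \<in> admissible n" "J \<in> D" using admissible_snocE[OF w(1)] by metis
      then show "y \<in> admissible n <+> X" using w(2) by (auto simp: g_def X_def)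
    qed
    show "inj_on g (admissible (Suc n))"
    proof (rule inj_onI)
      fix w w' assume ww: "w \<in> admissible (Suc n)" "w' \<in> admissible (Suc n)" and eq: "g w = g w'"
      obtain u J where uJ: "w = u @ [J]" "u \<in> admissible n" "J \<in> D" "nontrivial (?T u \<inter> J)"
        using admissible_snocE[OF ww(1)] by metis
      obtain u' J' where uJ': "w' = u' @ [J']" "u' \<in> admissible n" "J' \<in> D" "nontrivial (?T u' \<inter> J')"
        using admissible_snocE[OF ww(2)] by metis
      have uu: "u = u'" using eq uJ(1) uJ'(1) by (auto simp: g_def split: if_splits)
      have "J = J'"
      proof (cases "Inf J \<in> interior (?T u)")
        case True then show ?thesis
          using eq uJ(1) uJ'(1) by (auto simp: g_def split: if_splits)
      next
        case False
        then have False': "Inf J' \<notin> interior (?T u)"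
          using eq uJ(1) uJ'(1) uu by (auto simp: g_def split: if_splits)
        obtain p q where pq: "p < q" "?T u = {p..q}" "interior (?T u) = {p<..<q}"
          using T_Icc[OF uJ(2)] by blast
        \<comment> \<open>A lap that meets the image in more than a point without beginning inside
          it contains a right neighbourhood of the left end \<open>p\<close>; two such laps overlap
          and coincide.\<close>
        have *: "\<exists>v. p < v \<and> {p..min q v} \<subseteq> L"
          if L: "L \<in> D" "nontrivial (?T u \<inter> L)" "Inf L \<notin> interior (?T u)" for L
        proof -
          obtain s v where sv: "s < v" "L = {s..v}" using D_Icc[OF L(1)] by metis
          obtain x y where "x < y" "x \<in> {p..q} \<inter> {s..v}" "y \<in> {p..q} \<inter> {s..v}"
            using L(2) unfolding pq sv nontrivial_def by blast
          then have "s < q" "p < v" by auto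
          moreover have "Inf L = s" using sv by simp
          ultimately have "s \<le> p" using L(3) unfolding pq by auto
          then have "{p..min q v} \<subseteq> L" using sv by auto
          then show ?thesis using \<open>p < v\<close> by blast
        qed
        obtain v where v: "p < v" "{p..min q v} \<subseteq> J" using *[OF uJ(3,4) False] by blast
        obtain v' where v': "p < v'" "{p..min q v'} \<subseteq> J'"
          using *[OF uJ'(3)] uJ'(4) uu False' by blast
        have "{p..min q (min v v')} \<subseteq> J \<inter> J'" using v(2) v'(2) by auto
        moreover have "nontrivial {p..min q (min v v')}" using pq v v' by simp
        ultimately have "nontrivial (J \<inter> J')" by (metis nontrivial_mono)
        then show ?thesis using disj_D uJ(3) uJ'(3) by blast
      qed
      then show "w = w'" using uu uJ(1) uJ'(1) by simp
    qed
    show "finite (admissible n <+> X)" using finX by simp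
  qed
  also have "\<dots> = card (admissible n) + card X" using finX by (simp add: card_Plus)
  \<comment> \<open>The pair \<open>(m w, J)\<close> determines \<open>w\<close>: as
    \<open>h\<close> is injective inside \<open>m w\<close>, the point where it takes the value
    \<open>Inf J\<close> is unique, and it picks the cylinder.\<close>
  also have "card X \<le> card (m ` admissible n \<times> D)"
  proof (rule card_inj_on_le[where f = "\<lambda>(w,J). (m w, J)"])
    show "inj_on (\<lambda>(w,J). (m w, J)) X"
    proof (rule inj_onI)
      fix p q assume pq: "p \<in> X" "q \<in> X" "(\<lambda>(w,J). (m w, J)) p = (\<lambda>(w,J). (m w, J)) q"
      obtain w J w' where p: "p = (w,J)" "q = (w',J)" using pq(3) by (cases p; cases q) auto
      then have X: "(w,J) \<in> X" "(w',J) \<in> X" and mm: "m w = m w'" using pq by auto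
      have pre: "\<exists>y. y \<in> interior (cyl v) \<and> h y = Inf J" if v: "(v,J) \<in> X" for v
      proof -
        have va: "v \<in> admissible n" and vi: "Inf J \<in> interior (?T v)" using v by (auto simp: X_def)
        then have vw: "v \<in> words n" by (simp add: admissible_def)
        obtain c d where cd: "cyl v = {c..d}" "interior (cyl v) = {c<..<d}"
          using admissible_Icc[OF va] by metis
        obtain y where y: "y \<in> cyl v" "along v y = Inf J" using subsetD[OF interior_subset vi] by auto
        have "y \<in> interior (cyl v)"
          using mem_interior_of_image[of c d "along v" y] words_along[OF vw] y vi cd by simp
        then show ?thesis using h[OF va] y by auto
      qed
      obtain y where y: "y \<in> interior (cyl w)" "h y = Inf J" using pre[OF X(1)] by blast
      obtain y' where y': "y' \<in> interior (cyl w')" "h y' = Inf J" using pre[OF X(2)] by blast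
      have wa: "w \<in> admissible n" "w' \<in> admissible n" using X by (auto simp: X_def)
      have "y \<in> interior (m w)" "y' \<in> interior (m w)"
        using subsetD[OF interior_mono[OF m[OF wa(1)]] y(1)]
          subsetD[OF interior_mono[OF m[OF wa(2)]] y'(1)] mm by simp_all
      then have "y = y'" using inj_onD[OF inj[OF wa(1)], of y y'] y(2) y'(2) by simp
      then have "interior (cyl w \<inter> cyl w') \<noteq> {}" using y(1) y'(1) by auto
      then have "nontrivial (cyl w \<inter> cyl w')" by (rule nontrivial_if_interior)
      then show "p = q" using cyl_disjoint[of w n w'] wa p by (simp add: admissible_def)
    qed
    show "(\<lambda>(w,J). (m w, J)) ` X \<subseteq> m ` admissible n \<times> D" by (auto simp: X_def)
    show "finite (m ` admissible n \<times> D)" by (simp add: fin_D)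
  qed
  finally show ?thesis by (simp add: total_eq card_cartesian_product)
qed

end

text \<open>A finer filter takes the place of a subsequence: for uncountably many \<open>x\<close>
  the cube of functions into \<open>{0..1}\<close> is compact, but in general not sequentially
  compact.\<close>

lemma pointwise_cluster_filter:
  fixes \<Psi> :: "'t \<Rightarrow> 'x \<Rightarrow> real"
  assumes "F \<noteq> bot" and bd: "eventually (\<lambda>t. \<forall>x. \<Psi> t x \<in> {0..1}) F"
  obtains G \<psi> where "G \<le> F" "G \<noteq> bot" "\<And>x. ((\<lambda>t. \<Psi> t x) \<longlongrightarrow> \<psi> x) G"
proof -
  let ?U = "PiE UNIV (\<lambda>_::'x. {0..1::real})"
  have "compactin (product_topology (\<lambda>_::'x. euclidean) UNIV) ?U"
    by (subst compactin_PiE) simp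
  then have U: "compact ?U"
    by (simp add: euclidean_product_topology)
  have "eventually (\<lambda>\<phi>. \<phi> \<in> ?U) (filtermap \<Psi> F)"
    unfolding eventually_filtermap using bd by eventually_elim auto
  then obtain \<psi> where \<psi>: "inf (nhds \<psi>) (filtermap \<Psi> F) \<noteq> bot"
    using U assms(1) unfolding compact_filter by (metis filtermap_bot_iff)
  \<comment> \<open>The filter of those \<open>t\<close> far along \<open>F\<close> whose
    \<open>\<Psi> t\<close> is near \<open>\<psi>\<close>; it is proper because
    \<open>\<psi>\<close> is a cluster point.\<close>
  define G where "G = inf (filtercomap \<Psi> (nhds \<psi>)) F"
  have "G \<noteq> bot"
  proof
    assume "G = bot"
    then have "eventually (\<lambda>_. False) G" by simp
    then obtain P Q where PQ: "eventually P (filtercomap \<Psi> (nhds \<psi>))" "eventually Q F"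
      "\<And>t. P t \<and> Q t \<Longrightarrow> False"
      unfolding G_def eventually_inf by blast
    obtain P' where P': "eventually P' (nhds \<psi>)" "\<And>t. P' (\<Psi> t) \<Longrightarrow> P t"
      using PQ(1) unfolding eventually_filtercomap by blast
    have "eventually (\<lambda>\<phi>. \<exists>t. \<phi> = \<Psi> t \<and> Q t) (filtermap \<Psi> F)"
      unfolding eventually_filtermap using PQ(2) by eventually_elim auto
    then have "eventually (\<lambda>_. False) (inf (nhds \<psi>) (filtermap \<Psi> F))"
      unfolding eventually_inf using P' PQ(3) by blast
    then show False using \<psi> by (simp add: trivial_limit_def)
  qed
  moreover have "((\<lambda>t. \<Psi> t x) \<longlongrightarrow> \<psi> x) G" for x
  proof -
    have "filterlim \<Psi> (nhds \<psi>) G"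
      unfolding G_def filterlim_def
      by (metis filtermap_filtercomap filtermap_mono inf_le1 order_trans)
    moreover have "((\<lambda>\<phi>::'x \<Rightarrow> real. \<phi> x) \<longlongrightarrow> \<psi> x) (nhds \<psi>)"
    proof -
      have "((\<lambda>\<phi>::'x \<Rightarrow> real. \<phi> x) \<longlongrightarrow> \<psi> x) (at \<psi>)"
        using continuous_on_product_coordinates[of x] unfolding continuous_on_def by (rule bspec) simp
      then show ?thesis using tendsto_at_iff_tendsto_nhds[of "\<lambda>\<phi>. \<phi> x" \<psi>] by (rule iffD1[rotated])
    qed
    ultimately show ?thesis by (rule filterlim_compose[rotated])
  qed
  ultimately show ?thesis using that[of G \<psi>] by (simp add: G_def)
qed

lemma image_Icc_strict_mono:
  fixes \<phi> :: "real \<Rightarrow> real"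
  assumes "c \<le> d" "continuous_on {c..d} \<phi>" "strict_mono_on {c..d} \<phi>"
  shows "\<phi> ` {c..d} = {\<phi> c..\<phi> d}"
proof
  have m: "\<And>x y. x \<in> {c..d} \<Longrightarrow> y \<in> {c..d} \<Longrightarrow> x \<le> y \<Longrightarrow> \<phi> x \<le> \<phi> y"
    using assms(3) by (metis mono_onD strict_mono_iff_mono)
  show "\<phi> ` {c..d} \<subseteq> {\<phi> c..\<phi> d}" using m assms(1) by auto
  show "{\<phi> c..\<phi> d} \<subseteq> \<phi> ` {c..d}"
  proof
    fix y assume "y \<in> {\<phi> c..\<phi> d}"
    then obtain x where "c \<le> x" "x \<le> d" "\<phi> x = y" using IVT'[of \<phi> c y d] assms by auto
    then show "y \<in> \<phi> ` {c..d}" by auto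
  qed
qed

lemma image_Icc_strict_antimono:
  fixes \<phi> :: "real \<Rightarrow> real"
  assumes "c \<le> d" "continuous_on {c..d} \<phi>" "strict_antimono_on {c..d} \<phi>"
  shows "\<phi> ` {c..d} = {\<phi> d..\<phi> c}"
proof -
  have "(\<lambda>x. - \<phi> x) ` {c..d} = {- \<phi> c..- \<phi> d}"
    by (rule image_Icc_strict_mono)
      (use assms in \<open>auto intro!: continuous_intros simp: monotone_on_def\<close>)
  then have "uminus ` (\<lambda>x. - \<phi> x) ` {c..d} = uminus ` {- \<phi> c..- \<phi> d}" by simp
  then show ?thesis by (simp add: image_image)
qed

section \<open>Growth rate of the word counts\<close>

context lap_system begin

lemma total_0: "total 0 = 1"
  using ab by (simp add: count_0)

lemma count_le_total: "count n K \<le> total n"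
proof -
  have "{w \<in> words n. nontrivial (K \<inter> cyl w)} \<subseteq> admissible n"
    unfolding admissible_def using nontrivial_mono[OF _ Int_lower2] by auto
  then have "count n K \<le> card (admissible n)" unfolding count_def by (intro card_mono) auto
  then show ?thesis by (simp only: total_eq)
qed

text \<open>As in Fekete's lemma, submultiplicativity bounds the growth rate of \<open>c\<close>
  along multiples of \<open>n\<close> by \<open>ln (total n) / n\<close>, for each single
  \<open>n\<close>. The resulting bound carries no constant, so the series dominates a geometric one
  that diverges at \<open>1 / \<beta>\<close>.\<close>

lemma total_ge_power:
  assumes c: "\<And>n. c n \<le> total n" and "\<beta> > 1"
    and lim: "(\<lambda>n. ln (real (c n)) / real n) \<longlonglongrightarrow> ln \<beta>"
  shows "\<beta> ^ n \<le> real (total n)"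
proof (cases "n = 0")
  case True then show ?thesis by (simp add: total_0)
next
  case False
  have pk: "total (k * n) \<le> total n ^ k" for k
  proof (induction k)
    case 0 then show ?case by (simp add: total_0)
  next
    case (Suc k)
    have "total (Suc k * n) \<le> total n * total (k * n)"
      using total_submult[of n "k * n"] by simp
    also have "\<dots> \<le> total n * total n ^ k" using Suc by simp
    finally show ?case by simp
  qed
  have sub: "filterlim (\<lambda>k. k * n) at_top sequentially"
    using False by (intro mult_nat_right_at_top) simp
  have lim': "(\<lambda>k. ln (real (c (k * n))) / real (k * n)) \<longlonglongrightarrow> ln \<beta>"
    using filterlim_compose[OF lim sub] by simp
  have "ln \<beta> > 0" using \<open>\<beta> > 1\<close> by simp
  have "eventually (\<lambda>k. ln (real (c (k * n))) / real (k * n) \<le> ln (real (total n)) / real n) sequentially"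
    using order_tendstoD(1)[OF lim' \<open>ln \<beta> > 0\<close>] eventually_gt_at_top[of 0]
  proof eventually_elim
    case (elim k)
    then have "ln (real (c (k * n))) > 0" using \<open>\<beta> > 1\<close> False
      by (auto simp: zero_less_divide_iff mult_less_0_iff)
    \<comment> \<open>Since \<open>ln 0 = 0\<close>, a positive logarithm excludes the value
      0.\<close>
    then have c1: "real (c (k * n)) > 0" by (metis ln_0 less_irrefl of_nat_0_less_iff of_nat_0 bot_nat_0.not_eq_extremum)
    have "real (c (k * n)) \<le> real (total n ^ k)" using c[of "k * n"] pk[of k] by (metis of_nat_le_iff order_trans)
    then have le: "real (c (k * n)) \<le> real (total n) ^ k" by simp
    then have pos: "real (total n) > 0" using c1 \<open>k > 0\<close>
      by (metis less_le_trans of_nat_0_le_iff order_le_less power_eq_0_iff less_irrefl)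
    have "ln (real (c (k * n))) \<le> real k * ln (real (total n))"
      using le c1 pos by (metis ln_le_cancel_iff ln_realpow zero_less_power)
    then show ?case using elim False by (simp add: field_simps)
  qed
  then have "ln \<beta> \<le> ln (real (total n)) / real n"
    using tendsto_upperbound[OF lim'] by simp
  then have *: "real n * ln \<beta> \<le> ln (real (total n))" using False by (simp add: field_simps)
  have "0 < real n * ln \<beta>" using False \<open>\<beta> > 1\<close> by simp
  then have pos: "real (total n) > 0" using * by (metis ln_0 less_le_trans less_irrefl of_nat_0_less_iff of_nat_0 bot_nat_0.not_eq_extremum)
  have "\<beta> ^ n = exp (real n * ln \<beta>)" using \<open>\<beta> > 1\<close> by (simp add: exp_of_nat_mult)
  also have "\<dots> \<le> real (total n)" using * pos by (metis exp_le_cancel_iff exp_ln)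
  finally show ?thesis .
qed

text \<open>Lap numbers bound only the increments of the word counts, but increments of order
  \<open>\<gamma> ^ n\<close> with \<open>\<gamma> > 1\<close> add up to the same order. Taking
  \<open>\<gamma>\<close> slightly above \<open>\<beta>\<close>, with
  \<open>\<gamma> * t < 1\<close>, gives a geometric majorant.\<close>

lemma total_summable:
  assumes step: "\<And>n. total (Suc n) \<le> total n + c n * M" and "\<beta> > 1"
    and lim: "(\<lambda>n. ln (real (c n)) / real n) \<longlonglongrightarrow> ln \<beta>"
    and t: "0 \<le> t" "t < 1 / \<beta>"
  shows "summable (\<lambda>n. real (total n) * t ^ n)"
proof -
  obtain \<gamma> where \<gamma>: "\<beta> < \<gamma>" "\<gamma> * t < 1"
  proof (cases "t = 0")
    case True then show ?thesis using that[of "\<beta> + 1"] by simp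
  next
    case False
    then have "\<beta> < 1 / t" using t \<open>\<beta> > 1\<close> by (simp add: field_simps)
    then obtain \<gamma> where "\<beta> < \<gamma>" "\<gamma> < 1 / t" using dense by blast
    then show ?thesis using that[of \<gamma>] False t by (simp add: field_simps)
  qed
  have g1: "\<gamma> > 1" using \<gamma> \<open>\<beta> > 1\<close> by simp
  have "ln \<beta> < ln \<gamma>" using \<gamma>(1) \<open>\<beta> > 1\<close> by simp
  then have "eventually (\<lambda>n. ln (real (c n)) / real n < ln \<gamma>) sequentially"
    using order_tendstoD(2)[OF lim] by simp
  then obtain N where N: "\<And>n. n \<ge> N \<Longrightarrow> ln (real (c n)) / real n < ln \<gamma>"
    unfolding eventually_sequentially by blast
  \<comment> \<open>Starting at \<open>Suc N\<close> ensures \<open>n > 0\<close>, which is needed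
    to clear the denominator.\<close>
  have cN: "real (c n) \<le> \<gamma> ^ n" if "n \<ge> Suc N" for n
  proof (cases "c n = 0")
    case True then show ?thesis using g1 by simp
  next
    case False
    have "ln (real (c n)) \<le> real n * ln \<gamma>" using N[of n] that by (simp add: field_simps)
    then have "ln (real (c n)) \<le> ln (\<gamma> ^ n)" using g1 by (simp add: ln_realpow)
    then show ?thesis using False g1 by (simp add: ln_le_cancel_iff)
  qed
  \<comment> \<open>The sum absorbs the finitely many early terms; the 1 keeps \<open>C\<close>
    large enough for the later ones.\<close>
  define C where "C = 1 + (\<Sum>n\<le>N. real (c n))"
  have C1: "C \<ge> 1" by (simp add: C_def sum_nonneg)
  have cC: "real (c n) \<le> C * \<gamma> ^ n" for n
  proof (cases "n \<le> N")
    case True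
    then have "real (c n) \<le> (\<Sum>n\<le>N. real (c n))" by (intro member_le_sum) auto
    also have "\<dots> \<le> C * 1" by (simp add: C_def)
    also have "\<dots> \<le> C * \<gamma> ^ n" using C1 g1 by (intro mult_left_mono) auto
    finally show ?thesis .
  next
    case False
    then have "real (c n) \<le> 1 * \<gamma> ^ n" using cN by simp
    also have "\<dots> \<le> C * \<gamma> ^ n" using C1 g1 by (intro mult_right_mono) auto
    finally show ?thesis .
  qed
  \<comment> \<open>Chosen so that \<open>E + C * M \<le> E * \<gamma>\<close>, which is the
    induction step below; the 1 accounts for \<open>total 0 = 1\<close>.\<close>
  define E where "E = 1 + C * real M / (\<gamma> - 1)"
  have "E * (\<gamma> - 1) = (\<gamma> - 1) + C * real M" using g1 by (simp add: E_def distrib_right)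
  then have E: "E * (\<gamma> - 1) \<ge> C * real M" "E \<ge> 1" using g1 C1 by (auto simp: E_def)
  have tot: "real (total n) \<le> E * \<gamma> ^ n" for n
  proof (induction n)
    case 0 then show ?case using E by (simp add: total_0)
  next
    case (Suc n)
    have "real (total (Suc n)) \<le> real (total n + c n * M)" using step[of n] by (simp only: of_nat_le_iff)
    also have "\<dots> = real (total n) + real (c n) * real M" by simp
    also have "\<dots> \<le> E * \<gamma> ^ n + (C * \<gamma> ^ n) * real M"
      using Suc cC[of n] by (intro add_mono mult_right_mono) auto
    also have "\<dots> = \<gamma> ^ n * (E + C * real M)" by (simp add: algebra_simps)
    also have "\<dots> \<le> \<gamma> ^ n * (E + E * (\<gamma> - 1))" using E g1 by (intro mult_left_mono) auto
    also have "\<dots> = E * \<gamma> ^ Suc n" by (simp add: algebra_simps)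
    finally show ?case .
  qed
  have "summable (\<lambda>n. E * (\<gamma> * t) ^ n)"
    using \<gamma> t g1 by (intro summable_mult summable_geometric) auto
  then show ?thesis
  proof (rule summable_comparison_test'[where N = 0])
    fix n
    have "real (total n) * t ^ n \<le> E * \<gamma> ^ n * t ^ n" using tot t by (intro mult_right_mono) auto
    then show "norm (real (total n) * t ^ n) \<le> E * (\<gamma> * t) ^ n"
      using t by (simp add: power_mult_distrib mult.assoc)
  qed
qed

end

section \<open>The lap series and its normalized limit\<close>

definition (in lap_system) lap_series :: "real set \<Rightarrow> real \<Rightarrow> real" where
  "lap_series K t = (\<Sum>n. real (count n K) * t ^ n)"

text \<open>Summability keeps the series finite below \<open>1 / \<beta>\<close>, and the lower
  bound makes it blow up there. As \<open>\<beta> > 1\<close>, all parameters \<open>t\<close> stay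
  away from 1.\<close>

locale growing_lap_system = lap_system +
  fixes \<beta> :: real
  assumes beta: "\<beta> > 1"
    and total_lower: "\<beta> ^ n \<le> real (total n)"
    and total_sum: "0 \<le> t \<Longrightarrow> t < 1 / \<beta> \<Longrightarrow> summable (\<lambda>n. real (total n) * t ^ n)"
begin

context
  fixes t :: real
  assumes t: "0 \<le> t" "t < 1 / \<beta>"
begin

lemma t_less_1: "t < 1"
  using t beta by (meson divide_less_eq_1 less_trans zero_less_one)

lemma series_summable: "summable (\<lambda>n. real (count n K) * t ^ n)"
proof (rule summable_comparison_test'[where N = 0, OF total_sum[OF t]])
  fix n
  show "norm (real (count n K) * t ^ n) \<le> real (total n) * t ^ n"
    using count_le_total t by (simp add: mult_right_mono)
qed

lemma series_nonneg: "lap_series K t \<ge> 0"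
  unfolding lap_series_def using t by (intro suminf_nonneg series_summable) auto

lemma series_le_total: "lap_series K t \<le> lap_series {a..b} t"
  unfolding lap_series_def using t count_le_total
  by (intro suminf_le series_summable) (auto intro: mult_right_mono)

lemma series_trivial: "lap_series {c..c} t = 0"
  unfolding lap_series_def by (simp add: count_trivial nontrivial_iff)

lemma series_Suc:
  assumes "J \<in> D" "K \<subseteq> J" "nontrivial K"
  shows "lap_series K t = 1 + t * lap_series (F J ` K) t"
proof -
  have K: "K \<subseteq> {a..b}" using assms D_sub by blast
  have "lap_series K t = real (count 0 K) * t ^ 0 + (\<Sum>n. real (count (Suc n) K) * t ^ Suc n)"
    unfolding lap_series_def using suminf_split_head[OF series_summable[of K]] by simp
  also have "real (count 0 K) * t ^ 0 = 1" using count_0 assms K by simp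
  also have "(\<Sum>n. real (count (Suc n) K) * t ^ Suc n) = (\<Sum>n. t * (real (count n (F J ` K)) * t ^ n))"
    using count_Suc[OF assms(1,2)] by (simp add: mult_ac)
  also have "\<dots> = t * lap_series (F J ` K) t"
    unfolding lap_series_def by (rule suminf_mult[OF series_summable])
  finally show ?thesis .
qed

text \<open>Coefficientwise the error is at most 1, so it sums to at most the geometric series at
  \<open>t\<close>. Because \<open>\<beta> > 1\<close>, this is bounded uniformly in
  \<open>t < 1 / \<beta>\<close>.\<close>

lemma series_split:
  assumes "c \<le> d" "d \<le> e"
  shows "\<bar>lap_series {c..d} t + lap_series {d..e} t - lap_series {c..e} t\<bar> \<le> 1 / (1 - 1 / \<beta>)"
proof -
  let ?g = "\<lambda>n. real (count n {c..d}) * t ^ n + real (count n {d..e}) * t ^ n - real (count n {c..e}) * t ^ n"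
  have sg: "summable (\<lambda>n. t ^ n)" using t t_less_1 by (intro summable_geometric) simp
  have bound: "\<bar>?g n\<bar> \<le> t ^ n" for n
  proof -
    have "\<bar>real (count n {c..d}) + real (count n {d..e}) - real (count n {c..e})\<bar> \<le> 1"
      using count_split[OF assms, of n] by linarith
    then have "\<bar>real (count n {c..d}) + real (count n {d..e}) - real (count n {c..e})\<bar> * t ^ n \<le> 1 * t ^ n"
      using t by (intro mult_right_mono) auto
    moreover have "?g n = (real (count n {c..d}) + real (count n {d..e}) - real (count n {c..e})) * t ^ n"
      by (simp add: algebra_simps)
    ultimately show ?thesis using t by (simp add: abs_mult)
  qed
  have eq: "lap_series {c..d} t + lap_series {d..e} t - lap_series {c..e} t = suminf ?g"
    unfolding lap_series_def
    by (simp add: suminf_add suminf_diff series_summable summable_add)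
  have "summable (\<lambda>n. \<bar>?g n\<bar>)"
    by (rule summable_comparison_test'[where N = 0, OF sg]) (use bound in simp)
  then have "\<bar>suminf ?g\<bar> \<le> (\<Sum>n. \<bar>?g n\<bar>)" by (rule summable_rabs)
  also have "\<dots> \<le> (\<Sum>n. t ^ n)" using bound \<open>summable (\<lambda>n. \<bar>?g n\<bar>)\<close> sg by (intro suminf_le)
  also have "\<dots> = 1 / (1 - t)" using t t_less_1 by (intro suminf_geometric) simp
  also have "\<dots> \<le> 1 / (1 - 1 / \<beta>)" using t beta by (intro frac_le) auto
  finally show ?thesis unfolding eq .
qed

lemma series_total_ge: "1 / (1 - \<beta> * t) \<le> lap_series {a..b} t"
proof -
  have bt: "norm (\<beta> * t) < 1" using t beta by (simp add: field_simps)
  have "1 / (1 - \<beta> * t) = (\<Sum>n. (\<beta> * t) ^ n)" using suminf_geometric[OF bt] by simp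
  also have "\<dots> \<le> lap_series {a..b} t"
    unfolding lap_series_def using t total_lower
    by (intro suminf_le series_summable summable_geometric bt) (auto simp: power_mult_distrib intro: mult_right_mono)
  finally show ?thesis .
qed

lemma series_total_pos: "lap_series {a..b} t > 0"
proof -
  have "\<beta> * t < 1" using t beta by (simp add: field_simps)
  then have "0 < 1 / (1 - \<beta> * t)" by simp
  then show ?thesis using series_total_ge by linarith
qed

end

lemma series_total_at_top: "filterlim (lap_series {a..b}) at_top (at_left (1 / \<beta>))"
proof -
  have ev: "eventually (\<lambda>t. t \<in> {0<..<1 / \<beta>}) (at_left (1 / \<beta>))"
    using beta by (intro eventually_at_leftI[of 0]) auto
  have "((\<lambda>t. 1 - \<beta> * t) \<longlongrightarrow> 1 - \<beta> * (1 / \<beta>)) (at_left (1 / \<beta>))"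
    by (intro tendsto_intros)
  then have "((\<lambda>t. 1 - \<beta> * t) \<longlongrightarrow> 0) (at_left (1 / \<beta>))" using beta by simp
  moreover have "eventually (\<lambda>t. 1 - \<beta> * t > 0) (at_left (1 / \<beta>))"
    using ev by eventually_elim (use beta in \<open>auto simp: field_simps\<close>)
  ultimately have "filterlim (\<lambda>t. 1 - \<beta> * t) (at_right 0) (at_left (1 / \<beta>))"
    by (rule tendsto_imp_filterlim_at_right)
  then have "filterlim (\<lambda>t. inverse (1 - \<beta> * t)) at_top (at_left (1 / \<beta>))"
    using filterlim_compose[OF filterlim_inverse_at_top_right] by blast
  moreover have "eventually (\<lambda>t. inverse (1 - \<beta> * t) \<le> lap_series {a..b} t) (at_left (1 / \<beta>))"
    using ev by eventually_elim (use series_total_ge in \<open>auto simp: inverse_eq_divide\<close>)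
  ultimately show ?thesis by (rule filterlim_at_top_mono)
qed

text \<open>This is the limit of the functional equation, in which the factor \<open>t\<close>
  becomes \<open>1 / \<beta>\<close>. The absolute values let decreasing branches satisfy the same
  equation. At this stage \<open>\<psi>\<close> is only monotone.\<close>

lemma exists_semiconjugacy:
  obtains \<psi> where "mono_on {a..b} \<psi>" "\<psi> a = 0" "\<psi> b = 1"
    "\<And>J c d. J \<in> D \<Longrightarrow> c \<in> J \<Longrightarrow> d \<in> J \<Longrightarrow> \<bar>\<psi> (F J d) - \<psi> (F J c)\<bar> = \<beta> * \<bar>\<psi> d - \<psi> c\<bar>"
proof -
  let ?r = "1 / \<beta>"
  let ?L = lap_series
  define \<Psi> where "\<Psi> t x = ?L {a..x} t / ?L {a..b} t" for t x
  have ev: "eventually (\<lambda>t. t \<in> {0<..<?r}) (at_left ?r)"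
    using beta by (intro eventually_at_leftI[of 0]) auto
  then have "eventually (\<lambda>t. \<forall>x. \<Psi> t x \<in> {0..1}) (at_left ?r)"
  proof eventually_elim
    case (elim t)
    then have t: "0 \<le> t" "t < ?r" by auto
    show ?case
      using series_nonneg[OF t] series_le_total[OF t] series_total_pos[OF t]
      by (simp add: \<Psi>_def)
  qed
  then obtain G \<psi> where G: "G \<le> at_left ?r" "G \<noteq> bot" "\<And>x. ((\<lambda>t. \<Psi> t x) \<longlongrightarrow> \<psi> x) G"
    using pointwise_cluster_filter[of "at_left ?r" \<Psi>] by auto
  have evG: "eventually (\<lambda>t. 0 \<le> t \<and> t < ?r) G"
    using filter_leD[OF G(1) ev] by (rule eventually_mono) auto
  have tG: "((\<lambda>t. t) \<longlongrightarrow> ?r) G"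
    by (rule tendsto_mono[OF G(1)]) (rule tendsto_ident_at)
  \<comment> \<open>The reason for letting \<open>t\<close> tend to \<open>1 / \<beta>\<close>: the
    denominator becomes infinite, and every bounded term drops out of the limit.\<close>
  have inv0: "((\<lambda>t. C / ?L {a..b} t) \<longlongrightarrow> 0) G" for C
  proof -
    have "filterlim (?L {a..b}) at_top G"
      using series_total_at_top G(1) unfolding filterlim_def by (meson filtermap_mono order_trans)
    then have "filterlim (?L {a..b}) at_infinity G" by (rule filterlim_at_top_imp_at_infinity)
    then show ?thesis by (intro tendsto_divide_0[OF tendsto_const])
  qed
  \<comment> \<open>The splitting error vanishes after normalization, so an increment of
    \<open>\<psi>\<close> is the limit of the normalized series of the interval itself.\<close>
  have diff: "((\<lambda>t. ?L {c..d} t / ?L {a..b} t) \<longlongrightarrow> \<psi> d - \<psi> c) G"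
    if "a \<le> c" "c \<le> d" for c d
  proof -
    let ?C = "1 / (1 - 1 / \<beta>)"
    have "((\<lambda>t. (?L {a..c} t + ?L {c..d} t - ?L {a..d} t) / ?L {a..b} t) \<longlongrightarrow> 0) G"
    proof (rule Lim_null_comparison[OF _ inv0[of ?C]])
      show "eventually (\<lambda>t. norm ((?L {a..c} t + ?L {c..d} t - ?L {a..d} t) / ?L {a..b} t)
          \<le> ?C / ?L {a..b} t) G"
        using evG
      proof eventually_elim
        case (elim t)
        then have t: "0 \<le> t" "t < ?r" by auto
        show ?case
          using divide_right_mono[OF series_split[OF t that], of "?L {a..b} t"] series_total_pos[OF t]
          by (simp only: real_norm_def abs_divide abs_of_pos less_imp_le)
      qed
    qed
    then have "((\<lambda>t. (?L {a..c} t + ?L {c..d} t - ?L {a..d} t) / ?L {a..b} t + (\<Psi> t d - \<Psi> t c)) \<longlongrightarrow> 0 + (\<psi> d - \<psi> c)) G"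
      by (intro tendsto_intros G(3))
    then show ?thesis by (simp add: \<Psi>_def diff_divide_distrib add_divide_distrib)
  qed
  have le: "\<psi> c \<le> \<psi> d" if "a \<le> c" "c \<le> d" for c d
  proof -
    have "eventually (\<lambda>t. 0 \<le> ?L {c..d} t / ?L {a..b} t) G"
      using evG
    proof eventually_elim
      case (elim t)
      then show ?case using series_nonneg[of t] by simp
    qed
    then have "0 \<le> \<psi> d - \<psi> c" using tendsto_lowerbound[OF diff[OF that]] G(2) by metis
    then show ?thesis by simp
  qed
  \<comment> \<open>The constant term 1 vanishes in the limit and leaves exact scaling. Stating it
    through the image interval covers both orientations.\<close>
  have scale: "\<psi> q - \<psi> p = \<beta> * (\<psi> d - \<psi> c)"
    if J: "J \<in> D" and cd: "c \<in> J" "d \<in> J" "c < d" and im: "F J ` {c..d} = {p..q}" for J c d p q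
  proof -
    have sub: "{c..d} \<subseteq> J" using D_Icc[OF J] cd by (metis atLeastatMost_subset_iff atLeastAtMost_iff)
    have acd: "a \<le> c" using D_sub[OF J] cd by auto
    have "F J ` {c..d} \<subseteq> {a..b}" using maps_F[OF J] sub by blast
    moreover have "{p..q} \<noteq> {}" using im cd by force
    ultimately have pq: "a \<le> p" "p \<le> q" unfolding im by auto
    have "((\<lambda>t. 1 / ?L {a..b} t + t * (?L {p..q} t / ?L {a..b} t)) \<longlongrightarrow> 0 + ?r * (\<psi> q - \<psi> p)) G"
      by (intro tendsto_intros inv0 tG diff pq)
    moreover have "eventually (\<lambda>t. 1 / ?L {a..b} t + t * (?L {p..q} t / ?L {a..b} t) = ?L {c..d} t / ?L {a..b} t) G"
      using evG
    proof eventually_elim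
      case (elim t)
      then show ?case using series_Suc[of t J "{c..d}"] J sub cd(3) im by (simp add: add_divide_distrib)
    qed
    ultimately have "((\<lambda>t. ?L {c..d} t / ?L {a..b} t) \<longlongrightarrow> 0 + ?r * (\<psi> q - \<psi> p)) G"
      using tendsto_cong by fast
    then have "\<psi> d - \<psi> c = ?r * (\<psi> q - \<psi> p)"
      using tendsto_unique[OF G(2) diff[OF acd]] cd(3) by simp
    then show ?thesis using beta by simp
  qed
  have main: "\<bar>\<psi> (F J d) - \<psi> (F J c)\<bar> = \<beta> * \<bar>\<psi> d - \<psi> c\<bar>"
    if J: "J \<in> D" and cd: "c \<in> J" "d \<in> J" "c < d" for J c d
  proof -
    have sub: "{c..d} \<subseteq> J" using D_Icc[OF J] cd by (metis atLeastatMost_subset_iff atLeastAtMost_iff)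
    have cont: "continuous_on {c..d} (F J)" using cont_F[OF J] sub by (rule continuous_on_subset)
    have "\<psi> c \<le> \<psi> d" using le cd D_sub[OF J] by auto
    moreover have "\<psi> (F J d) - \<psi> (F J c) = \<beta> * (\<psi> d - \<psi> c) \<or> \<psi> (F J c) - \<psi> (F J d) = \<beta> * (\<psi> d - \<psi> c)"
      using strict_F[OF J]
    proof
      assume "strict_mono_on J (F J)"
      then have "strict_mono_on {c..d} (F J)" using sub by (rule monotone_on_subset)
      then show ?thesis using scale[OF J cd] image_Icc_strict_mono[OF _ cont] cd(3) by simp
    next
      assume "strict_antimono_on J (F J)"
      then have "strict_antimono_on {c..d} (F J)" using sub by (rule monotone_on_subset)
      then show ?thesis using scale[OF J cd] image_Icc_strict_antimono[OF _ cont] cd(3) by simp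
    qed
    moreover from calculation(1) have "0 \<le> \<beta> * (\<psi> d - \<psi> c)" using beta by simp
    ultimately show ?thesis by auto
  qed
  have main': "\<bar>\<psi> (F J d) - \<psi> (F J c)\<bar> = \<beta> * \<bar>\<psi> d - \<psi> c\<bar>"
    if "J \<in> D" "c \<in> J" "d \<in> J" for J c d
    using main[OF that(1), of c d] main[OF that(1), of d c] that
    by (cases c d rule: linorder_cases) (auto simp: abs_minus_commute)
  have "\<psi> b = 1"
  proof -
    have "eventually (\<lambda>t. \<Psi> t b = 1) G" using evG
    proof eventually_elim
      case (elim t)
      then show ?case using series_total_pos[of t] by (simp add: \<Psi>_def)
    qed
    then have "((\<lambda>t. \<Psi> t b) \<longlongrightarrow> 1) G" by (rule tendsto_eventually)
    then show ?thesis using tendsto_unique[OF G(2) G(3)] by blast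
  qed
  moreover have "\<psi> a = 0"
  proof -
    have "eventually (\<lambda>t. \<Psi> t a = 0) G" using evG
    proof eventually_elim
      case (elim t)
      then show ?case using series_trivial[of t] by (simp add: \<Psi>_def)
    qed
    then have "((\<lambda>t. \<Psi> t a) \<longlongrightarrow> 0) G" by (rule tendsto_eventually)
    then show ?thesis using tendsto_unique[OF G(2) G(3)] by blast
  qed
  moreover have "mono_on {a..b} \<psi>" using le by (intro mono_onI) auto
  ultimately show ?thesis using that[of \<psi>] main' by blast
qed

text \<open>Finitely many closed pieces cover the segment from \<open>x\<close> to \<open>e\<close>,
  so \<open>x\<close> is a limit point of the part of the segment in one of them, even if it is a
  common endpoint. The segment treats left and right alike.\<close>

lemma one_sided_branch:
  assumes x: "x \<in> {a..b}" and e: "e \<in> {a..b}" and ne: "x \<noteq> e"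
  obtains J y where "J \<in> D" "x \<in> J" "y \<in> J" "y \<noteq> x" "y \<in> closed_segment x e"
proof -
  have sub: "closed_segment x e \<subseteq> {a..b}"
    using x e by (intro closed_segment_subset) auto
  have "x islimpt closed_segment x e"
    using ne by (intro connected_imp_perfect) (auto, metis ends_in_segment singletonD)
  also have "closed_segment x e = (\<Union>J\<in>D. J \<inter> closed_segment x e)"
    using sub cover by auto
  finally obtain J where J: "J \<in> D" "x islimpt (J \<inter> closed_segment x e)"
    using islimpt_finite_union_iff[OF fin_D] by metis
  have "closed J" using D_Icc[OF J(1)] by (metis closed_atLeastAtMost)
  then have "x \<in> J" using J(2) closed_limpt by (metis islimpt_subset Int_lower1)
  moreover obtain y where "y \<in> J \<inter> closed_segment x e" "y \<noteq> x"
    using J(2) unfolding islimpt_def by (metis UNIV_I open_UNIV)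
  ultimately show ?thesis using that[OF J(1), of y] by simp
qed

text \<open>
  For every \<open>n\<close>, a one-sided neighbourhood of \<open>x\<close> lies in a single branch of \<open>f\<^sup>n\<close>, so its mass
  under \<open>d\<psi>\<close> is at most \<open>\<beta>\<^sup>-\<^sup>n\<close>; hence \<open>d\<psi>\<close> has no atoms.
\<close>

lemma one_sided_oscillation:
  assumes mono: "mono_on {a..b} \<psi>" and end01: "\<psi> a = 0" "\<psi> b = 1"
    and scale: "\<And>J c d. J \<in> D \<Longrightarrow> c \<in> J \<Longrightarrow> d \<in> J \<Longrightarrow>
      \<bar>\<psi> (F J d) - \<psi> (F J c)\<bar> = \<beta> * \<bar>\<psi> d - \<psi> c\<bar>"
    and "x \<in> {a..b}" "e \<in> {a..b}" "x \<noteq> e"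
  shows "\<exists>y\<in>closed_segment x e. y \<noteq> x \<and> \<bar>\<psi> y - \<psi> x\<bar> \<le> (1 / \<beta>) ^ n"
  using assms(5-7)
proof (induction n arbitrary: x e)
  case 0
  have "0 \<le> \<psi> z \<and> \<psi> z \<le> 1" if "z \<in> {a..b}" for z
    using mono_onD[OF mono, of a z] mono_onD[OF mono, of z b] that end01 ab by simp
  then have "\<bar>\<psi> e - \<psi> x\<bar> \<le> 1" using 0(1,2) by (smt (verit))
  then show ?case using 0(3) by (intro bexI[of _ e]) auto
next
  case (Suc n)
  obtain J e' where J: "J \<in> D" "x \<in> J" "e' \<in> J" "e' \<noteq> x" "e' \<in> closed_segment x e"
    using one_sided_branch[OF Suc.prems] by metis
  have seg: "closed_segment x e' \<subseteq> J"
    using D_Icc[OF J(1)] J(2,3) by (metis closed_segment_subset convex_real_interval(5))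
  have "F J x \<noteq> F J e'" using inj_F[OF J(1)] J(2-4) by (metis inj_onD)
  moreover have "F J x \<in> {a..b}" "F J e' \<in> {a..b}" using maps_F[OF J(1)] J(2,3) by auto
  ultimately obtain y where y: "y \<in> closed_segment (F J x) (F J e')" "y \<noteq> F J x"
    "\<bar>\<psi> y - \<psi> (F J x)\<bar> \<le> (1 / \<beta>) ^ n"
    using Suc.IH by metis
  \<comment> \<open>The image of the segment is an interval, so the point \<open>y\<close> supplied
    by the induction hypothesis on the image side has a preimage \<open>z\<close> in the segment;
    scaling gains one factor \<open>1 / \<beta>\<close>.\<close>
  have "connected (F J ` closed_segment x e')"
    using continuous_on_subset[OF cont_F[OF J(1)] seg] by (intro connected_continuous_image) auto
  then have "convex (F J ` closed_segment x e')"
    by (simp add: is_interval_connected_1 is_interval_convex_1 flip: is_interval_connected_1)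
  then have "closed_segment (F J x) (F J e') \<subseteq> F J ` closed_segment x e'"
    by (intro closed_segment_subset) auto
  then obtain z where z: "z \<in> closed_segment x e'" "y = F J z" using y(1) by blast
  have "\<beta> * \<bar>\<psi> z - \<psi> x\<bar> \<le> (1 / \<beta>) ^ n"
    using scale[OF J(1,2), of z] seg z y(3) by auto
  then have "\<bar>\<psi> z - \<psi> x\<bar> \<le> (1 / \<beta>) ^ Suc n" using beta by (simp add: field_simps)
  moreover have "z \<in> closed_segment x e"
    using z(1) J(5) by (meson ends_in_segment(1) subset_closed_segment subsetD)
  moreover have "z \<noteq> x" using z(2) y(2) by auto
  ultimately show ?case by blast
qed

text \<open>For a monotone function, a single point \<open>y\<close> with small increment on one
  side of \<open>x\<close> controls everything between \<open>x\<close> and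
  \<open>y\<close>.\<close>

lemma semiconjugacy_continuous:
  assumes mono: "mono_on {a..b} \<psi>" and end01: "\<psi> a = 0" "\<psi> b = 1"
    and scale: "\<And>J c d. J \<in> D \<Longrightarrow> c \<in> J \<Longrightarrow> d \<in> J \<Longrightarrow>
      \<bar>\<psi> (F J d) - \<psi> (F J c)\<bar> = \<beta> * \<bar>\<psi> d - \<psi> c\<bar>"
  shows "continuous_on {a..b} \<psi>"
  unfolding continuous_on_iff
proof (intro ballI allI impI)
  fix x \<epsilon> :: real
  assume x: "x \<in> {a..b}" and "\<epsilon> > 0"
  have "1 / \<beta> < 1" "0 < 1 / \<beta>" using beta by auto
  then obtain n where n: "(1 / \<beta>) ^ n < \<epsilon>" using real_arch_pow_inv[OF \<open>\<epsilon> > 0\<close>] by blast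
  note osc = one_sided_oscillation[OF mono end01 scale x, where n = n]
  have "\<exists>u>x. \<forall>z\<in>{a..b}. x \<le> z \<and> z < u \<longrightarrow> \<bar>\<psi> z - \<psi> x\<bar> < \<epsilon>"
  proof (cases "x = b")
    case True
    have "\<bar>\<psi> z - \<psi> x\<bar> < \<epsilon>" if "z \<in> {a..b}" "x \<le> z" for z
      using that True \<open>\<epsilon> > 0\<close> by (simp add: antisym)
    then show ?thesis by (intro exI[of _ "x + 1"]) auto
  next
    case False
    then obtain y where y: "y \<in> closed_segment x b" "y \<noteq> x" "\<bar>\<psi> y - \<psi> x\<bar> \<le> (1 / \<beta>) ^ n"
      using osc[of b] ab by auto
    then have xy: "x < y" "y \<le> b" using x by (auto simp: closed_segment_eq_real_ivl)
    have "\<bar>\<psi> z - \<psi> x\<bar> < \<epsilon>" if "z \<in> {a..b}" "x \<le> z" "z < y" for z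
      using mono_onD[OF mono, of x z] mono_onD[OF mono, of z y] that x xy y(3) n by simp
    then show ?thesis using xy by blast
  qed
  then obtain u where u: "u > x" "\<And>z. z \<in> {a..b} \<Longrightarrow> x \<le> z \<Longrightarrow> z < u \<Longrightarrow> \<bar>\<psi> z - \<psi> x\<bar> < \<epsilon>"
    by blast
  have "\<exists>v<x. \<forall>z\<in>{a..b}. v < z \<and> z \<le> x \<longrightarrow> \<bar>\<psi> z - \<psi> x\<bar> < \<epsilon>"
  proof (cases "x = a")
    case True
    have "\<bar>\<psi> z - \<psi> x\<bar> < \<epsilon>" if "z \<in> {a..b}" "z \<le> x" for z
      using that True \<open>\<epsilon> > 0\<close> by (simp add: antisym)
    then show ?thesis by (intro exI[of _ "x - 1"]) auto
  next
    case False
    then obtain y where y: "y \<in> closed_segment x a" "y \<noteq> x" "\<bar>\<psi> y - \<psi> x\<bar> \<le> (1 / \<beta>) ^ n"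
      using osc[of a] ab by auto
    then have xy: "y < x" "a \<le> y" using x by (auto simp: closed_segment_eq_real_ivl split: if_splits)
    have "\<bar>\<psi> z - \<psi> x\<bar> < \<epsilon>" if "z \<in> {a..b}" "z \<le> x" "y < z" for z
      using mono_onD[OF mono, of z x] mono_onD[OF mono, of y z] that x xy y(3) n by simp
    then show ?thesis using xy by blast
  qed
  then obtain v where v: "v < x" "\<And>z. z \<in> {a..b} \<Longrightarrow> v < z \<Longrightarrow> z \<le> x \<Longrightarrow> \<bar>\<psi> z - \<psi> x\<bar> < \<epsilon>"
    by blast
  show "\<exists>\<delta>>0. \<forall>z\<in>{a..b}. dist z x < \<delta> \<longrightarrow> dist (\<psi> z) (\<psi> x) < \<epsilon>"
  proof (intro exI[of _ "min (u - x) (x - v)"] conjI ballI impI)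
    show "0 < min (u - x) (x - v)" using u v by simp
    fix z assume z: "z \<in> {a..b}" "dist z x < min (u - x) (x - v)"
    then have "v < z" "z < u" by (auto simp: dist_real_def)
    then show "dist (\<psi> z) (\<psi> x) < \<epsilon>"
      using u(2)[OF z(1)] v(2)[OF z(1)] by (cases "x \<le> z") (auto simp: dist_real_def)
  qed
qed

text \<open>Monotonicity of \<open>\<psi>\<close> and of the branch fixes the sign inside the
  absolute values, leaving slope \<open>\<beta>\<close> or \<open>- \<beta>\<close>. Weak
  monotonicity is enough, as \<open>\<psi>\<close> is not yet known to be injective.\<close>

lemma semiconjugacy_affine:
  assumes mono: "mono_on {a..b} \<psi>"
    and scale: "\<And>J c d. J \<in> D \<Longrightarrow> c \<in> J \<Longrightarrow> d \<in> J \<Longrightarrow>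
      \<bar>\<psi> (F J d) - \<psi> (F J c)\<bar> = \<beta> * \<bar>\<psi> d - \<psi> c\<bar>"
    and J: "J \<in> D"
  shows "\<exists>m q. \<bar>m\<bar> = \<beta> \<and> (\<forall>x\<in>J. \<psi> (F J x) = m * \<psi> x + q)"
proof -
  obtain c d where cd: "c < d" "J = {c..d}" "a \<le> c" "d \<le> b" using D_Icc[OF J] by metis
  have F: "F J x \<in> {a..b}" if "x \<in> J" for x using maps_F[OF J] that by blast
  have c: "\<psi> c \<le> \<psi> x" if "x \<in> J" for x using mono_onD[OF mono, of c x] that cd by simp
  have cJ: "c \<in> J" using cd by simp
  from strict_F[OF J] show ?thesis
  proof
    assume "strict_mono_on J (F J)"
    then have "F J c \<le> F J x" if "x \<in> J" for x
      using that cd mono_onD[of J "F J" c x] by (simp add: strict_mono_iff_mono)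
    then have "\<psi> (F J c) \<le> \<psi> (F J x)" if "x \<in> J" for x
      using mono_onD[OF mono F[OF cJ] F[OF that]] that by simp
    then have "\<psi> (F J x) = \<beta> * \<psi> x + (\<psi> (F J c) - \<beta> * \<psi> c)" if "x \<in> J" for x
      using scale[OF J cJ that] c[OF that] that by (simp add: algebra_simps)
    then show ?thesis using beta by (intro exI[of _ \<beta>] exI[of _ "\<psi> (F J c) - \<beta> * \<psi> c"]) auto
  next
    assume "strict_antimono_on J (F J)"
    then have "F J x \<le> F J c" if "x \<in> J" for x
      using that cd monotone_onD[of J "(\<le>)" "(\<ge>)" "F J" c x] by (simp add: strict_antimono_iff_antimono)
    then have "\<psi> (F J x) \<le> \<psi> (F J c)" if "x \<in> J" for x
      using mono_onD[OF mono F[OF that] F[OF cJ]] that by simp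
    then have "\<psi> (F J x) = - \<beta> * \<psi> x + (\<psi> (F J c) + \<beta> * \<psi> c)" if "x \<in> J" for x
      using scale[OF J cJ that] c[OF that] that by (simp add: algebra_simps)
    then show ?thesis using beta by (intro exI[of _ "- \<beta>"] exI[of _ "\<psi> (F J c) + \<beta> * \<psi> c"]) auto
  qed
qed

end

section \<open>Branches\<close>

text \<open>By uniqueness of limits, the one-sided limit in \<open>branch\<close> is the value of
  any continuous extension from the open interval.\<close>

lemma branch_eq_extension:
  fixes f F :: "real \<Rightarrow> real"
  assumes "c < d" "continuous_on {c..d} F" "\<And>x. x \<in> {c<..<d} \<Longrightarrow> F x = f x" "x \<in> {c..d}"
  shows "branch f {c..d} x = F x"
proof (cases "x \<in> {c<..<d}")
  case True
  then show ?thesis using assms(3) by (simp add: branch_def interior_atLeastAtMost_real)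
next
  case False
  have "x islimpt {c<..<d}"
  proof -
    have "x = c \<or> x = d" using False assms(4) by auto
    then show ?thesis
      using islimpt_greaterThanLessThan1[OF assms(1)] islimpt_greaterThanLessThan2[OF assms(1)] by auto
  qed
  then have nt: "\<not> trivial_limit (at x within {c<..<d})" by (simp add: trivial_limit_within)
  have "(F \<longlongrightarrow> F x) (at x within {c..d})" using assms(2,4) by (simp add: continuous_on_def)
  then have "(F \<longlongrightarrow> F x) (at x within {c<..<d})" by (rule tendsto_within_subset) auto
  moreover have "eventually (\<lambda>y. F y = f y) (at x within {c<..<d})"
    using assms(3) by (auto simp: eventually_at_filter)
  ultimately have "(f \<longlongrightarrow> F x) (at x within {c<..<d})" by (rule Lim_transform_eventually)
  then have "Lim (at x within {c<..<d}) f = F x" using nt by (intro tendsto_Lim)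
  then show ?thesis using False by (auto simp: branch_def interior_atLeastAtMost_real)
qed

text \<open>Bounded monotone maps have one-sided limits. Strictness survives at the endpoints
  because two points \<open>u < v\<close> fit strictly between \<open>x\<close> and
  \<open>y\<close>.\<close>

lemma strict_mono_extension:
  fixes f :: "real \<Rightarrow> real"
  assumes cd: "c < d" and cont: "continuous_on {c<..<d} f" and mono: "strict_mono_on {c<..<d} f"
    and bd: "f ` {c<..<d} \<subseteq> {a..b}"
  shows "\<exists>F. continuous_on {c..d} F \<and> strict_mono_on {c..d} F \<and> (\<forall>x\<in>{c<..<d}. F x = f x)"
proof -
  have sm: "f x < f y" if "x \<in> {c<..<d}" "y \<in> {c<..<d}" "x < y" for x y
    using mono that by (meson strict_mono_onD)
  have ml: "f x \<le> f y" if "x \<in> {c<..<d}" "y \<in> {c<..<d}" "x \<le> y" for x y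
    using sm[of x y] that by (cases "x = y") auto
  have bds: "a \<le> f x" "f x \<le> b" if "x \<in> {c<..<d}" for x
    using subsetD[OF bd imageI[OF that]] by simp_all
  obtain l where l: "(f \<longlongrightarrow> l) (at_right c)"
  proof -
    have "{c<..} \<inter> {c<..<d} = {c<..<d}" by auto
    then have "(f \<longlongrightarrow> Inf (f ` {c<..<d})) (at c within {c<..<d})"
      using Lim_right_bound[of "{c<..<d}" c f a] ml bds(1) by simp
    moreover have "at c within {c<..<d} = at_right c"
      using cd by (intro at_within_nhd[of c "{..<d}"]) auto
    ultimately show ?thesis using that by simp
  qed
  obtain r where r: "(f \<longlongrightarrow> r) (at_left d)"
  proof -
    have "{..<d} \<inter> {c<..<d} = {c<..<d}" by auto
    then have "(f \<longlongrightarrow> Sup (f ` {c<..<d})) (at d within {c<..<d})"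
      using Lim_left_bound[of "{c<..<d}" d f b] ml bds(2) by simp
    moreover have "at d within {c<..<d} = at_left d"
      using cd by (intro at_within_nhd[of d "{c<..}"]) auto
    ultimately show ?thesis using that by simp
  qed
  define F where "F x = (if x = c then l else if x = d then r else f x)" for x
  have eq: "F x = f x" if "x \<in> {c<..<d}" for x using that by (simp add: F_def)
  have Fr: "(F \<longlongrightarrow> F c) (at_right c)"
  proof (rule Lim_transform_eventually)
    show "(f \<longlongrightarrow> F c) (at_right c)" using l by (simp add: F_def)
    show "eventually (\<lambda>x. f x = F x) (at_right c)"
      using cd by (intro eventually_at_rightI[of c d]) (simp_all add: eq)
  qed
  have Fl: "(F \<longlongrightarrow> F d) (at_left d)"
  proof (rule Lim_transform_eventually)
    show "(f \<longlongrightarrow> F d) (at_left d)" using r cd by (simp add: F_def)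
    show "eventually (\<lambda>x. f x = F x) (at_left d)"
      using cd by (intro eventually_at_leftI[of c d]) (simp_all add: eq)
  qed
  have "continuous_on {c..d} F"
  proof (rule continuous_on_IccI[OF Fr Fl _ cd])
    fix x assume x: "c < x" "x < d"
    have "continuous_on {c<..<d} F" using cont eq continuous_on_cong[of "{c<..<d}" "{c<..<d}" F f] by simp
    then show "(F \<longlongrightarrow> F x) (at x)"
      using x by (simp add: continuous_on_eq_continuous_at continuous_at)
  qed
  moreover have "strict_mono_on {c..d} F"
  proof (rule strict_mono_onI)
    fix x y assume xy: "x \<in> {c..d}" "y \<in> {c..d}" "x < y"
    have lo: "F c \<le> F z" if z: "z \<in> {c<..<d}" for z
    proof (rule tendsto_upperbound[OF Fr])
      show "eventually (\<lambda>x. F x \<le> F z) (at_right c)"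
        using z by (intro eventually_at_rightI[of c z]) (auto simp: eq ml)
    qed simp
    have hi: "F z \<le> F d" if z: "z \<in> {c<..<d}" for z
    proof (rule tendsto_lowerbound[OF Fl])
      show "eventually (\<lambda>x. F z \<le> F x) (at_left d)"
        using z by (intro eventually_at_leftI[of z d]) (auto simp: eq ml)
    qed simp
    obtain u where u: "x < u" "u < y" using dense xy(3) by blast
    obtain v where v: "u < v" "v < y" using dense u(2) by blast
    have uv: "u \<in> {c<..<d}" "v \<in> {c<..<d}" using u v xy by auto
    have "F x \<le> F u"
    proof (cases "x = c")
      case False
      then have "x \<in> {c<..<d}" using xy u by auto
      then show ?thesis using uv u ml by (simp add: eq)
    qed (use lo uv in simp)
    also have "F u < F v" using sm uv v by (simp add: eq)
    also have "F v \<le> F y"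
    proof (cases "y = d")
      case False
      then have "y \<in> {c<..<d}" using xy u by auto
      then show ?thesis using uv v ml by (simp add: eq)
    qed (use hi uv in simp)
    finally show "F x < F y" .
  qed
  ultimately show ?thesis using eq by blast
qed

lemma inj_extension:
  fixes f :: "real \<Rightarrow> real"
  assumes cd: "c < d" and cont: "continuous_on {c<..<d} f" and inj: "inj_on f {c<..<d}"
    and bd: "f ` {c<..<d} \<subseteq> {a..b}"
  shows "\<exists>F. continuous_on {c..d} F \<and> inj_on F {c..d} \<and> (\<forall>x\<in>{c<..<d}. F x = f x)"
proof -
  have "is_interval {c<..<d}" by (simp add: is_interval_oo)
  then consider "strict_mono_on {c<..<d} f" | "strict_antimono_on {c<..<d} f"
    using cont_inj_iff_cont_strict[OF _ cont] inj by metis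
  then show ?thesis
  proof cases
    case 1
    then show ?thesis using strict_mono_extension[OF cd cont 1 bd] strict_mono_on_imp_inj_on by metis
  next
    case 2
    have "\<exists>F. continuous_on {c..d} F \<and> strict_mono_on {c..d} F \<and> (\<forall>x\<in>{c<..<d}. F x = - f x)"
    proof (rule strict_mono_extension[OF cd])
      show "continuous_on {c<..<d} (\<lambda>x. - f x)" using cont by (rule continuous_on_minus)
      show "strict_mono_on {c<..<d} (\<lambda>x. - f x)" using 2 by (auto simp: monotone_on_def)
      show "(\<lambda>x. - f x) ` {c<..<d} \<subseteq> {-b..-a}" using bd by auto
    qed
    then obtain F where F: "continuous_on {c..d} F" "strict_mono_on {c..d} F"
      "\<And>x. x \<in> {c<..<d} \<Longrightarrow> F x = - f x" by blast
    have "continuous_on {c..d} (\<lambda>x. - F x)" using F(1) by (rule continuous_on_minus)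
    moreover have "inj_on (\<lambda>x. - F x) {c..d}"
      using strict_mono_on_imp_inj_on[OF F(2)] by (simp add: inj_on_def)
    moreover have "\<forall>x\<in>{c<..<d}. - F x = f x" using F(3) by simp
    ultimately show ?thesis by (intro exI[of _ "\<lambda>x. - F x"] conjI)
  qed
qed

lemma branch_props:
  fixes f :: "real \<Rightarrow> real"
  assumes nc: "nowhere_constant_on {a..b} f" and maps: "f ` {a..b} \<subseteq> {a..b}"
    and J: "cm_interval {a..b} f J"
  shows "continuous_on J (branch f J)" "inj_on (branch f J) J" "branch f J ` J \<subseteq> {a..b}"
proof -
  obtain c d where cd: "c < d" "J = {c..d}" "interior J = {c<..<d}" "J \<subseteq> {a..b}"
    "cont_monotone_on {c<..<d} f" using cm_intervalE[OF J] by metis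
  have sub: "{c<..<d} \<subseteq> {a..b}" using cd by auto
  have bd: "f ` {c<..<d} \<subseteq> {a..b}" using image_mono[OF sub] maps by (rule order_trans)
  have inj: "inj_on f {c<..<d}" using cm_interval_inj[OF nc J] cd(3) by simp
  obtain F where F: "continuous_on {c..d} F" "inj_on F {c..d}" "\<And>x. x \<in> {c<..<d} \<Longrightarrow> F x = f x"
    using inj_extension[OF cd(1) _ inj bd] cd(5) unfolding cont_monotone_on_def by metis
  have eq: "branch f J x = F x" if "x \<in> J" for x
    using branch_eq_extension[OF cd(1) F(1,3), of x] that cd(2) by simp
  show "continuous_on J (branch f J)" using F(1) eq cd(2) by (metis continuous_on_cong)
  show "inj_on (branch f J) J" using F(2) eq cd(2) by (simp add: inj_on_def)
  have "F ` closure {c<..<d} \<subseteq> {a..b}"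
  proof (rule image_closure_subset)
    show "continuous_on (closure {c<..<d}) F" using F(1) cd(1) by simp
    show "F ` {c<..<d} \<subseteq> {a..b}" using bd F(3) by auto
  qed simp
  then show "branch f J ` J \<subseteq> {a..b}" using eq cd by auto
qed

lemma lap_system_laps:
  assumes "a < b" and f: "pcpm {a..b} f" and nc: "nowhere_constant_on {a..b} f"
  shows "lap_system a b (laps {a..b} f) (branch f)"
proof
  have div: "laps {a..b} f division_of {a..b}" by (rule laps_division(1)[OF nc f])
  have cm: "\<And>J. J \<in> laps {a..b} f \<Longrightarrow> cm_interval {a..b} f J" by (rule laps_division(2)[OF nc f])
  have maps: "f ` {a..b} \<subseteq> {a..b}" using f by (simp add: pcpm_def)
  show "a < b" by fact
  show "finite (laps {a..b} f)" "\<Union>(laps {a..b} f) = {a..b}"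
    using div by (auto simp: division_of_def)
  show "nd_interval J" if "J \<in> laps {a..b} f" for J using cm[OF that] by (simp add: cm_interval_def)
  show "\<not> nontrivial (J \<inter> J')" if J: "J \<in> laps {a..b} f" "J' \<in> laps {a..b} f" "J \<noteq> J'" for J J'
  proof
    assume nt: "nontrivial (J \<inter> J')"
    obtain c d where "J = {c..d}" using cm_intervalE[OF cm[OF J(1)]] by metis
    moreover obtain c' d' where "J' = {c'..d'}" using cm_intervalE[OF cm[OF J(2)]] by metis
    ultimately have "is_interval (J \<inter> J')" by (simp add: is_interval_cc)
    then have "interior (J \<inter> J') \<noteq> {}" using nt by (intro interior_if_nontrivial_interval)
    then show False using division_ofD(5)[OF div J] by simp
  qed
  show "continuous_on J (branch f J)" "inj_on (branch f J) J" "branch f J ` J \<subseteq> {a..b}"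
    if "J \<in> laps {a..b} f" for J
    by (rule branch_props[OF nc maps cm[OF that]])+
qed

section \<open>Laps of the iterates\<close>

context
  fixes a b :: real and f :: "real \<Rightarrow> real"
  assumes sys: "lap_system a b (laps {a..b} f) (branch f)"
begin

interpretation lap_system a b "laps {a..b} f" "branch f" by (rule sys)

text \<open>\<open>iter_branches\<close> adds the next lap at the end, while \<open>cyl\<close>
  peels letters off the front; \<open>cyl_append\<close> joins the two. The condition on interiors
  is admissibility, cylinders being intervals.\<close>

lemma iter_branches_eq:
  "iter_branches {a..b} f n = (\<lambda>w. (cyl w, along w)) ` admissible n"
proof (induction n)
  case 0
  have "along [] = (\<lambda>x. x)" by auto
  moreover have "admissible 0 = {[]}" using ab by (auto simp: admissible_def words_0)
  ultimately show ?case by simp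
next
  case (Suc n)
  have app: "cyl (w @ [J]) = cyl w \<inter> along w -` J" "along (w @ [J]) = branch f J \<circ> along w"
    "w @ [J] \<in> words (Suc n)"
    "w @ [J] \<in> admissible (Suc n) \<longleftrightarrow> interior (cyl w \<inter> along w -` J) \<noteq> {}"
    if w: "w \<in> admissible n" and J: "J \<in> laps {a..b} f" for w J
  proof -
    have "J \<inter> branch f J -` {a..b} = J" using maps_F[OF J] by auto
    then show eq: "cyl (w @ [J]) = cyl w \<inter> along w -` J" using cyl_append[of "[J]" w] J by simp
    show "along (w @ [J]) = branch f J \<circ> along w" by (rule ext) (simp add: along_append)
    show wd: "w @ [J] \<in> words (Suc n)" using w J by (simp add: admissible_def words_def)
    show "w @ [J] \<in> admissible (Suc n) \<longleftrightarrow> interior (cyl w \<inter> along w -` J) \<noteq> {}"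
      unfolding eq[symmetric] admissible_def
      using wd interior_if_nontrivial_interval[OF _ words_cyl(2)[OF wd]]
        nontrivial_if_interior[of "cyl (w @ [J])"] by auto
  qed
  show ?case
  proof (intro equalityI subsetI)
    fix p assume "p \<in> iter_branches {a..b} f (Suc n)"
    then obtain K \<phi> J where p: "p = (K \<inter> \<phi> -` J, branch f J \<circ> \<phi>)" "(K, \<phi>) \<in> iter_branches {a..b} f n"
      "J \<in> laps {a..b} f" "interior (K \<inter> \<phi> -` J) \<noteq> {}" by auto
    then obtain w where w: "w \<in> admissible n" "K = cyl w" "\<phi> = along w" unfolding Suc by auto
    have "p = (cyl (w @ [J]), along (w @ [J]))" using app(1,2)[OF w(1) p(3)] w p by simp
    moreover have "w @ [J] \<in> admissible (Suc n)" using app(4)[OF w(1) p(3)] w p by simp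
    ultimately show "p \<in> (\<lambda>w. (cyl w, along w)) ` admissible (Suc n)" by blast
  next
    fix p assume "p \<in> (\<lambda>w. (cyl w, along w)) ` admissible (Suc n)"
    then obtain v where v: "v \<in> admissible (Suc n)" "p = (cyl v, along v)" by blast
    obtain w J where w: "v = w @ [J]" "w \<in> admissible n" "J \<in> laps {a..b} f"
      using admissible_snocE[OF v(1)] by metis
    have "(cyl w, along w) \<in> iter_branches {a..b} f n" unfolding Suc using w(2) by blast
    moreover have "interior (cyl w \<inter> along w -` J) \<noteq> {}" using app(4)[OF w(2,3)] v w by simp
    moreover have "p = (cyl w \<inter> along w -` J, branch f J \<circ> along w)" using app(1,2)[OF w(2,3)] v w by simp
    ultimately show "p \<in> iter_branches {a..b} f (Suc n)" using w(3) by auto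
  qed
qed

text \<open>An interior point lies in no other admissible cylinder, since such a cylinder would
  overlap this one even if the point were its endpoint. So the description in \<open>iterate\<close>
  has exactly one solution.\<close>

lemma iterate_eq:
  assumes w: "w \<in> admissible n" and x: "x \<in> interior (cyl w)"
  shows "iterate {a..b} f n x = along w x"
proof -
  have uniq: "w' = w" if w': "w' \<in> admissible n" "x \<in> cyl w'" for w'
  proof -
    obtain c d where cd: "cyl w = {c..d}" "interior (cyl w) = {c<..<d}" using admissible_Icc[OF w] by metis
    obtain c' d' where cd': "c' < d'" "cyl w' = {c'..d'}" using admissible_Icc[OF w'(1)] by metis
    have "c < x" "x < d" "c' \<le> x" "x \<le> d'" using x w'(2) unfolding cd(2) cd'(2) by simp_all
    then have "nontrivial {max c c'..min d d'}" using cd'(1) by simp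
    then have "nontrivial (cyl w' \<inter> cyl w)" by (rule nontrivial_mono) (simp add: cd(1) cd'(2))
    then show ?thesis using cyl_disjoint[of w' n w] w w' by (simp add: admissible_def)
  qed
  have xw: "x \<in> cyl w" using subsetD[OF interior_subset x] .
  have "(\<forall>(K,\<phi>)\<in>iter_branches {a..b} f n. x \<in> K \<longrightarrow> \<phi> x = y) \<longleftrightarrow> along w x = y" (is "?L \<longleftrightarrow> _") for y
  proof -
    have "?L \<longleftrightarrow> (\<forall>w'\<in>admissible n. x \<in> cyl w' \<longrightarrow> along w' x = y)"
      unfolding iter_branches_eq by simp
    also have "\<dots> \<longleftrightarrow> along w x = y" using uniq w xw by metis
    finally show ?thesis .
  qed
  then show ?thesis unfolding iterate_def by simp
qed

lemma iterate_cm: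
  assumes w: "w \<in> admissible n"
  shows "cm_interval {a..b} (iterate {a..b} f n) (cyl w)"
proof -
  have ww: "w \<in> words n" using w by (simp add: admissible_def)
  obtain c d where cd: "c < d" "cyl w = {c..d}" "interior (cyl w) = {c<..<d}" "a \<le> c" "d \<le> b"
    using admissible_Icc[OF w] by metis
  have "cont_monotone_on (cyl w) (along w)"
    using words_cyl(2)[OF ww] words_along(1,2)[OF ww] by (rule cont_inj_imp_cont_monotone)
  then have "cont_monotone_on (interior (cyl w)) (along w)"
    using interior_subset by (rule cont_monotone_on_subset)
  then have "cont_monotone_on (interior (cyl w)) (iterate {a..b} f n)"
    using iterate_eq[OF w] by (simp cong: cont_monotone_on_cong)
  then show ?thesis using cd by (auto simp: cm_interval_def nd_interval_def)
qed

text \<open>Off the finite set \<open>E\<close> of uncovered points and cylinder ends, the iterate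
  is locally a single injective branch.\<close>

lemma iterate_nowhere_constant: "nowhere_constant_on {a..b} (iterate {a..b} f n)"
  unfolding nowhere_constant_on_def
proof (intro allI impI)
  fix c d :: real assume cd: "c < d" "{c..d} \<subseteq> {a..b}"
  define E where
    "E = ({a..b} - (\<Union>w\<in>admissible n. cyl w)) \<union> (\<Union>w\<in>admissible n. cyl w - interior (cyl w))"
  have "finite (cyl w - interior (cyl w))" if w: "w \<in> admissible n" for w
  proof -
    obtain u v where uv: "cyl w = {u..v}" "interior (cyl w) = {u<..<v}"
      using admissible_Icc[OF w] by metis
    have "cyl w - interior (cyl w) \<subseteq> {u,v}" unfolding uv by auto
    then show ?thesis by (rule finite_subset) simp
  qed
  then have "finite E" unfolding E_def using finite_uncovered by simp
  then have "infinite ({c<..<d} - E)" using cd(1) by (simp add: Diff_infinite_finite)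
  then obtain x where x: "x \<in> {c<..<d}" "x \<notin> E" by (metis Diff_iff finite.emptyI equals0I)
  have "x \<in> {a..b}" using x(1) cd(2) by auto
  then obtain w where w: "w \<in> admissible n" "x \<in> interior (cyl w)" using x(2) unfolding E_def by auto
  have "interior ({c<..<d} \<inter> interior (cyl w)) \<noteq> {}" using x w by auto
  then have "nontrivial ({c<..<d} \<inter> interior (cyl w))" by (rule nontrivial_if_interior)
  then obtain u v where uv: "u \<in> {c<..<d}" "u \<in> interior (cyl w)" "v \<in> {c<..<d}" "v \<in> interior (cyl w)" "u \<noteq> v"
    unfolding nontrivial_iff by auto
  have "w \<in> words n" using w by (simp add: admissible_def)
  moreover have "u \<in> cyl w" "v \<in> cyl w" using uv interior_subset by (metis subsetD)+
  ultimately have "along w u \<noteq> along w v" using words_along(2) uv(5) by (metis inj_onD)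
  then have "iterate {a..b} f n u \<noteq> iterate {a..b} f n v" using iterate_eq w(1) uv by simp
  moreover have "u \<in> {c..d}" "v \<in> {c..d}" using uv by auto
  ultimately show "\<exists>x\<in>{c..d}. \<exists>y\<in>{c..d}. iterate {a..b} f n x \<noteq> iterate {a..b} f n y" by blast
qed

text \<open>The bridge between entropy, defined by laps, and word counts. Each lap of the iterate
  contains an admissible cylinder but may contain several, so in the other direction only the
  increment is controlled.\<close>

lemma lap_number_bounds:
  "lap_number {a..b} f n \<le> total n"
  "total (Suc n) \<le> total n + lap_number {a..b} f n * card (laps {a..b} f)"
proof -
  let ?h = "iterate {a..b} f n"
  let ?P = "cyl ` admissible n"
  obtain m where m: "laps {a..b} ?h = m ` ?P" "\<And>J. J \<in> ?P \<Longrightarrow> J \<subseteq> m J"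
  proof (rule laps_from_cover[OF iterate_nowhere_constant[of n], of ?P])
    show "finite ({a..b} - \<Union>?P)" using finite_uncovered[of n] by simp
  qed (use iterate_cm in auto)
  have eq: "lap_number {a..b} f n = card ((\<lambda>w. m (cyl w)) ` admissible n)"
    unfolding lap_number_def m(1) by (simp add: image_image)
  show "lap_number {a..b} f n \<le> total n" unfolding eq total_eq by (intro card_image_le) simp
  show "total (Suc n) \<le> total n + lap_number {a..b} f n * card (laps {a..b} f)"
    unfolding eq
  proof (rule total_Suc_le)
    show "cyl w \<subseteq> m (cyl w)" if "w \<in> admissible n" for w using m(2) that by simp
    show "?h x = along w x" if "w \<in> admissible n" "x \<in> interior (cyl w)" for w x
      using iterate_eq that by simp
    show "inj_on ?h (interior (m (cyl w)))" if "w \<in> admissible n" for w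
    proof -
      have "m (cyl w) \<in> laps {a..b} ?h" using that m(1) by simp
      then have "cm_interval {a..b} ?h (m (cyl w))"
        unfolding laps_eq_max_cm[OF iterate_nowhere_constant] by (rule max_cmD)
      then show ?thesis by (rule cm_interval_inj[OF iterate_nowhere_constant])
    qed
  qed
qed

lemma growing_lap_system_laps:
  assumes "has_entropy {a..b} f (ln \<beta>)" "\<beta> > 1"
  shows "growing_lap_system a b (laps {a..b} f) (branch f) \<beta>"
proof
  have lim: "(\<lambda>n. ln (real (lap_number {a..b} f n)) / real n) \<longlonglongrightarrow> ln \<beta>"
    using assms(1) by (simp add: has_entropy_def)
  show "\<beta> > 1" by fact
  show "\<beta> ^ n \<le> real (total n)" for n
    by (rule total_ge_power[OF lap_number_bounds(1) \<open>\<beta> > 1\<close> lim])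
  show "summable (\<lambda>n. real (total n) * t ^ n)" if "0 \<le> t" "t < 1 / \<beta>" for t
    by (rule total_summable[OF lap_number_bounds(2) \<open>\<beta> > 1\<close> lim that])
qed

end

section \<open>Dense orbits\<close>

text \<open>A repetition would make the orbit finite, hence closed, and it could not be
  dense.\<close>

lemma dense_orbit_inj:
  fixes f :: "real \<Rightarrow> real"
  assumes "a < b" and dense: "{a..b} \<subseteq> closure (range (\<lambda>n. (f ^^ n) x))"
  shows "inj (\<lambda>n. (f ^^ n) x)"
proof (rule ccontr)
  assume "\<not> inj (\<lambda>n. (f ^^ n) x)"
  then obtain i j where ij: "i < j" "(f ^^ i) x = (f ^^ j) x"
    unfolding inj_on_def by (metis linorder_neqE_nat)
  have "(f ^^ n) x \<in> (\<lambda>k. (f ^^ k) x) ` {..<j}" for n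
  proof (induction n rule: less_induct)
    case (less n)
    show ?case
    proof (cases "n < j")
      case False
      then have "(f ^^ n) x = (f ^^ (n - j + j)) x" by simp
      also have "\<dots> = (f ^^ (n - j)) ((f ^^ j) x)" by (simp only: funpow_add comp_apply)
      also have "\<dots> = (f ^^ (n - j + i)) x" by (simp only: funpow_add comp_apply ij(2))
      finally show ?thesis using less[of "n - j + i"] False ij(1) by simp
    qed simp
  qed
  then have "range (\<lambda>n. (f ^^ n) x) \<subseteq> (\<lambda>k. (f ^^ k) x) ` {..<j}" by blast
  then have fin: "finite (range (\<lambda>n. (f ^^ n) x))" by (rule finite_subset) simp
  then have "closure (range (\<lambda>n. (f ^^ n) x)) = range (\<lambda>n. (f ^^ n) x)"
    by (simp add: finite_imp_closed)
  then have "finite {a..b}" using dense fin by (metis finite_subset)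
  then show False using \<open>a < b\<close> infinite_Icc by blast
qed

text \<open>After finitely many visits, deleting the visited points would leave a nonempty open set
  missed by the orbit.\<close>

lemma dense_orbit_visits:
  fixes f :: "real \<Rightarrow> real"
  assumes dense: "{a..b} \<subseteq> closure (range (\<lambda>n. (f ^^ n) x))"
    and cd: "c < d" "{c..d} \<subseteq> {a..b}"
  shows "infinite {n. (f ^^ n) x \<in> {c<..<d}}"
proof
  let ?N = "{n. (f ^^ n) x \<in> {c<..<d}}"
  let ?E = "(\<lambda>n. (f ^^ n) x) ` ?N"
  assume "finite ?N"
  then have fin: "finite ?E" by simp
  have "infinite ({c<..<d} - ?E)" using cd(1) fin by (simp add: Diff_infinite_finite)
  then obtain y where y: "y \<in> {c<..<d} - ?E" by (metis finite.emptyI equals0I)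
  have "open ({c<..<d} - ?E)" using fin by (intro open_Diff finite_imp_closed) auto
  moreover have "y \<in> closure (range (\<lambda>n. (f ^^ n) x))" using y dense cd(2) by auto
  ultimately obtain n where "(f ^^ n) x \<in> {c<..<d} - ?E"
    using y unfolding closure_iff_nhds_not_empty by blast
  then show False by blast
qed

text \<open>Two visits to an interval of constancy would have the same successor, against
  injectivity of the orbit.\<close>

lemma transitive_nowhere_constant:
  assumes "a < b" "{a..b} \<subseteq> closure (range (\<lambda>n. (f ^^ n) x))"
  shows "nowhere_constant_on {a..b} f"
  unfolding nowhere_constant_on_def
proof (intro allI impI)
  fix c d :: real assume cd: "c < d" "{c..d} \<subseteq> {a..b}"
  let ?N = "{n. (f ^^ n) x \<in> {c<..<d}}"
  have inf: "infinite ?N" by (rule dense_orbit_visits[OF assms(2) cd])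
  obtain n where n: "n \<in> ?N" using inf by (metis finite.emptyI equals0I)
  obtain m where m: "m \<in> ?N - {n}" using inf by (metis finite.emptyI equals0I infinite_remove)
  have "(f ^^ Suc n) x \<noteq> (f ^^ Suc m) x"
    using injD[OF dense_orbit_inj[OF assms], of "Suc n" "Suc m"] m by auto
  then have "f ((f ^^ n) x) \<noteq> f ((f ^^ m) x)" by simp
  moreover have "(f ^^ n) x \<in> {c..d}" "(f ^^ m) x \<in> {c..d}" using n m by auto
  ultimately show "\<exists>x\<in>{c..d}. \<exists>y\<in>{c..d}. f x \<noteq> f y" by blast
qed

text \<open>Off \<open>B\<close> the next position depends only on the current one, so from a
  landing point in \<open>S\<close> the walk retraces a chosen run until it meets \<open>B\<close>
  or \<open>w 0\<close>. Finitely many landing points, with one finite run from each to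
  \<open>w 0\<close>, exhaust the walk.\<close>

lemma recurrent_walk_finite:
  fixes w :: "nat \<Rightarrow> 'c"
  assumes fin: "finite B" "finite S"
    and det: "\<And>i. w i \<notin> B \<Longrightarrow> w (Suc i) = nxt (w i)"
    and succ: "\<And>i. w i \<in> B \<Longrightarrow> w (Suc i) \<in> S"
    and rec: "infinite {i. w i = w 0}"
  shows "finite (range w)"
proof -
  let ?B = "insert (w 0) B" and ?S = "insert (w 1) S \<inter> range w"
  have "\<exists>i k. w i = s \<and> w (i + k) = w 0" if s: "s \<in> ?S" for s
  proof -
    obtain i where i: "w i = s" using s by auto
    obtain j where "j \<ge> i" "w j = w 0" using rec unfolding infinite_nat_iff_unbounded_le by blast
    then show ?thesis using i by (intro exI[of _ i] exI[of _ "j - i"]) simp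
  qed
  then obtain i k where ik: "\<And>s. s \<in> ?S \<Longrightarrow> w (i s) = s \<and> w (i s + k s) = w 0" by metis
  \<comment> \<open>One run up to a return to \<open>w 0\<close> for each landing point, including
    the successor \<open>w 1\<close> of the start. A run may cross \<open>B\<close>; the steps from
    there are covered by \<open>S\<close>.\<close>
  define Q where "Q = ?B \<union> (\<Union>s\<in>?S. (\<lambda>l. w (i s + l)) ` {..k s})"
  have SQ: "?S \<subseteq> Q"
  proof
    fix s assume s: "s \<in> ?S"
    then have "s = w (i s + 0)" using ik by simp
    then show "s \<in> Q" using s unfolding Q_def by (metis (no_types, lifting) UN_I UnI2 atMost_iff image_eqI zero_le)
  qed
  have step: "w (Suc j) \<in> Q" if j: "w j \<in> Q" for j
  proof -
    consider "w j \<in> B" | "w j \<notin> B" "w j = w 0" | "w j \<notin> B" "w j \<noteq> w 0" by blast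
    then show ?thesis
    proof cases
      case 1 then show ?thesis using succ SQ by blast
    next
      case 2
      then have "w (Suc j) = w 1" using det[of j] det[of 0] by simp
      then show ?thesis using SQ by auto
    next
      case 3
      then obtain s l where sl: "s \<in> ?S" "l \<le> k s" "w j = w (i s + l)" using j unfolding Q_def by auto
      \<comment> \<open>The run ends at \<open>w 0\<close>, which this case excludes, so its next
        position still belongs to \<open>Q\<close>.\<close>
      then have "l \<noteq> k s" using ik 3(2) by auto
      then have "Suc l \<in> {..k s}" using sl(2) by simp
      moreover have "w (Suc j) = w (i s + Suc l)" using det[of j] det[of "i s + l"] 3(1) sl(3) by simp
      ultimately show ?thesis using sl(1) unfolding Q_def by blast
    qed
  qed
  have "w j \<in> Q" for j by (induction j) (simp add: Q_def, rule step)
  then have "range w \<subseteq> Q" by blast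
  moreover have "finite Q" unfolding Q_def using fin by auto
  ultimately show ?thesis by (rule finite_subset)
qed

section \<open>Constant slope\<close>

text \<open>
  If \<open>\<psi>\<close> is constant on \<open>{c..d}\<close>, the image under \<open>\<psi>\<close> of the dense orbit is a walk that is
  recurrent and deterministic except at the finitely many images of lap endpoints.
  It is therefore finite, although it is dense in \<open>{0..1}\<close>.
\<close>

lemma (in growing_lap_system) semiconjugacy_inj:
  assumes mono: "mono_on {a..b} \<psi>" and cont: "continuous_on {a..b} \<psi>" and end01: "\<psi> a = 0" "\<psi> b = 1"
    and affine: "\<And>J. J \<in> D \<Longrightarrow> \<exists>m q. \<bar>m\<bar> = \<beta> \<and> (\<forall>x\<in>J. \<psi> (F J x) = m * \<psi> x + q)"
    and f: "\<And>J x. J \<in> D \<Longrightarrow> x \<in> interior J \<Longrightarrow> f x = F J x" "f ` {a..b} \<subseteq> {a..b}"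
    and x0: "x0 \<in> {a..b}" and dense: "{a..b} \<subseteq> closure (range (\<lambda>n. (f ^^ n) x0))"
  shows "inj_on \<psi> {a..b}"
proof (rule ccontr)
  assume "\<not> inj_on \<psi> {a..b}"
  then obtain c d where cd: "c \<in> {a..b}" "d \<in> {a..b}" "c < d" "\<psi> c = \<psi> d"
    unfolding inj_on_def by (metis linorder_neqE_linordered_idom)
  define X where "X n = (f ^^ n) x0" for n
  have X_in: "X n \<in> {a..b}" for n
  proof (induction n)
    case (Suc n)
    then show ?case using f(2) by (simp add: X_def image_subset_iff)
  qed (use x0 in \<open>simp add: X_def\<close>)
  have X_inj: "inj X" unfolding X_def by (rule dense_orbit_inj[OF ab dense])
  \<comment> \<open>Lap endpoints, where \<open>f\<close> need not follow a branch; the orbit, being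
    injective, meets them finitely often.\<close>
  define E where "E = Inf ` D \<union> Sup ` D"
  have "finite E" using fin_D by (simp add: E_def)
  then have "finite (X -` E)" using X_inj by (rule finite_vimageI)
  then obtain N where N: "\<And>n. n \<in> X -` E \<Longrightarrow> n < N"
    using finite_nat_set_iff_bounded by metis
  have "{c..d} \<subseteq> {a..b}" using cd by auto
  then have visits: "infinite {n. X n \<in> {c<..<d}}"
    unfolding X_def using dense_orbit_visits[OF dense cd(3)] by simp
  \<comment> \<open>The walk starts after the last visit to a lap endpoint and inside the flat
    interval, so that every later visit to the interval is a return to \<open>w 0\<close>.\<close>
  then obtain n0 where n0: "n0 \<ge> N" "X n0 \<in> {c<..<d}"
    unfolding infinite_nat_iff_unbounded_le by auto
  have flat: "\<psi> z = \<psi> c" if "z \<in> {c<..<d}" for z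
    using mono_onD[OF mono, of c z] mono_onD[OF mono, of z d] that cd by simp
  obtain M Q where MQ: "\<And>J x. J \<in> D \<Longrightarrow> x \<in> J \<Longrightarrow> \<psi> (F J x) = M J * \<psi> x + Q J"
    using affine by metis
  define w where "w k = \<psi> (X (n0 + k))" for k
  define B where "B = \<psi> ` E"
  define S where "S = (\<lambda>(J, y). M J * y + Q J) ` (D \<times> B)"
  \<comment> \<open>Off \<open>B\<close> the value of \<open>\<psi>\<close> determines the lap, so
    there the choice is the only possible one; on \<open>B\<close> nothing is claimed.\<close>
  define nxt where "nxt y = (let J = SOME J. J \<in> D \<and> y \<in> \<psi> ` J in M J * y + Q J)" for y
  have lap: "\<exists>J\<in>D. X (n0 + k) \<in> interior J \<and> w (Suc k) = M J * w k + Q J" for k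
  proof -
    obtain J where J: "J \<in> D" "X (n0 + k) \<in> J" using X_in cover by blast
    obtain u v where uv: "u < v" "J = {u..v}" using D_Icc[OF J(1)] by metis
    have "X (n0 + k) \<notin> E" using N[of "n0 + k"] n0(1) by auto
    moreover have "u \<in> E" "v \<in> E" unfolding E_def using J(1) uv
      by (metis UnI1 cInf_atLeastAtMost image_eqI less_imp_le, metis UnI2 cSup_atLeastAtMost image_eqI less_imp_le)
    ultimately have "X (n0 + k) \<noteq> u" "X (n0 + k) \<noteq> v" by auto
    then have int: "X (n0 + k) \<in> interior J"
      using J(2) unfolding uv(2) by (simp add: interior_atLeastAtMost_real)
    have "X (Suc (n0 + k)) = F J (X (n0 + k))" using f(1)[OF J(1) int] by (simp add: X_def)
    then show ?thesis using MQ[OF J] J int by (auto simp: w_def)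
  qed
  have det: "w (Suc k) = nxt (w k)" if wB: "w k \<notin> B" for k
  proof -
    obtain J where J: "J \<in> D" "X (n0 + k) \<in> interior J" "w (Suc k) = M J * w k + Q J" using lap by blast
    have XJ: "X (n0 + k) \<in> J" by (rule subsetD[OF interior_subset J(2)])
    \<comment> \<open>A second lap attaining the same value would make \<open>\<psi>\<close>
      constant from the orbit point to an endpoint of \<open>J\<close>, and the value would lie in
      \<open>B\<close>.\<close>
    have uniq: "J' = J" if J': "J' \<in> D" "w k \<in> \<psi> ` J'" for J'
    proof (rule ccontr)
      assume ne: "J' \<noteq> J"
      obtain z where z: "z \<in> J'" "w k = \<psi> z" using J'(2) by blast
      obtain u v where uv: "u < v" "J = {u..v}" "a \<le> u" "v \<le> b" using D_Icc[OF J(1)] by metis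
      obtain u' v' where uv': "u' < v'" "J' = {u'..v'}" using D_Icc[OF J'(1)] by metis
      have E: "u \<in> E" "v \<in> E" unfolding E_def using J(1) uv
        by (metis UnI1 cInf_atLeastAtMost image_eqI less_imp_le, metis UnI2 cSup_atLeastAtMost image_eqI less_imp_le)
      have zab: "z \<in> {a..b}" using D_sub[OF J'(1)] z(1) by blast
      have Xuv: "u \<le> X (n0 + k)" "X (n0 + k) \<le> v" using XJ unfolding uv(2) by simp_all
      have zX: "\<psi> z = \<psi> (X (n0 + k))" using z(2) by (simp add: w_def)
      consider "z \<le> u" | "v \<le> z" | "u < z" "z < v" by linarith
      then show False
      proof cases
        case 1
        then have "\<psi> z \<le> \<psi> u" "\<psi> u \<le> \<psi> (X (n0 + k))"
          using mono_onD[OF mono] zab uv X_in Xuv by auto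
        then have "w k = \<psi> u" using zX by (simp add: w_def)
        then show False using wB E(1) by (simp add: B_def)
      next
        case 2
        then have "\<psi> v \<le> \<psi> z" "\<psi> (X (n0 + k)) \<le> \<psi> v"
          using mono_onD[OF mono] zab uv X_in Xuv by auto
        then have "w k = \<psi> v" using zX by (simp add: w_def)
        then show False using wB E(2) by (simp add: B_def)
      next
        case 3
        then have "nontrivial {max u u'..min v v'}" using z(1) uv(1) uv'(1) unfolding uv'(2) by simp
        then have "nontrivial (J' \<inter> J)" by (rule nontrivial_mono) (simp add: uv(2) uv'(2))
        then show False using disj_D[OF J'(1) J(1) ne] by simp
      qed
    qed
    have wJ: "w k \<in> \<psi> ` J" unfolding w_def using XJ by (rule imageI)
    have "(SOME J. J \<in> D \<and> w k \<in> \<psi> ` J) = J"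
    proof (rule some_equality)
      show "J \<in> D \<and> w k \<in> \<psi> ` J" using J(1) wJ by (rule conjI)
      show "J' = J" if "J' \<in> D \<and> w k \<in> \<psi> ` J'" for J'
        using that by (elim conjE) (rule uniq)
    qed
    then show ?thesis using J(3) by (simp add: nxt_def)
  qed
  have succ: "w (Suc k) \<in> S" if "w k \<in> B" for k
  proof -
    obtain J where "J \<in> D" "w (Suc k) = M J * w k + Q J" using lap by blast
    then show ?thesis using that unfolding S_def by (intro image_eqI[of _ _ "(J, w k)"]) auto
  qed
  have rec: "infinite {k. w k = w 0}"
    unfolding infinite_nat_iff_unbounded_le
  proof
    fix m
    obtain n where n: "n \<ge> n0 + m" "X n \<in> {c<..<d}"
      using visits unfolding infinite_nat_iff_unbounded_le by auto
    then have "w (n - n0) = w 0" using flat n0(2) by (simp add: w_def)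
    then show "\<exists>k\<ge>m. k \<in> {k. w k = w 0}" using n(1) by (intro exI[of _ "n - n0"]) auto
  qed
  have "finite B" "finite S" using \<open>finite E\<close> fin_D by (simp_all add: B_def S_def)
  then have fin: "finite (range w)" using det succ rec by (rule recurrent_walk_finite)
  define V where "V = range w \<union> (\<lambda>n. \<psi> (X n)) ` {..<n0}"
  have finV: "finite V" using fin by (simp add: V_def)
  have inV: "\<psi> (X n) \<in> V" for n
  proof (cases "n < n0")
    case False
    then have "\<psi> (X n) = w (n - n0)" by (simp add: w_def)
    then show ?thesis by (simp add: V_def)
  qed (simp add: V_def)
  \<comment> \<open>The closed preimage of the finite set \<open>V\<close> contains the dense orbit,
    hence the whole interval; but \<open>\<psi>\<close> is onto \<open>{0..1}\<close>.\<close>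
  have "closed ({a..b} \<inter> \<psi> -` V)"
    using cont closed_atLeastAtMost finite_imp_closed[OF finV] by (rule continuous_closed_preimage)
  moreover have "range X \<subseteq> {a..b} \<inter> \<psi> -` V" using X_in inV by auto
  ultimately have "closure (range X) \<subseteq> {a..b} \<inter> \<psi> -` V" by (rule closure_minimal[rotated])
  then have "\<psi> ` {a..b} \<subseteq> V" using dense unfolding X_def by auto
  moreover have "{0..1} \<subseteq> \<psi> ` {a..b}"
  proof
    fix y :: real assume "y \<in> {0..1}"
    then obtain x where "a \<le> x" "x \<le> b" "\<psi> x = y" using IVT'[of \<psi> a y b] end01 ab cont by auto
    then show "y \<in> \<psi> ` {a..b}" by auto
  qed
  ultimately have "finite {0..1::real}" using finV by (meson finite_subset order_trans)
  then show False using infinite_Icc[of "0::real" 1] by simp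
qed

text \<open>The point \<open>x\<close> may be an end of the piece, where the value of
  \<open>g\<close> is not prescribed. Differentiability implies continuity, so \<open>g x\<close> is
  the affine value, and the difference quotients taken inside the piece all equal
  \<open>m\<close>.\<close>

lemma derivative_eq_slope:
  fixes g :: "real \<Rightarrow> real"
  assumes cd: "c < d" and g: "\<And>y. y \<in> {c<..<d} \<Longrightarrow> g y = m * y + q"
    and x: "x \<in> {c..d}" and sub: "{c..d} \<subseteq> T"
    and deriv: "(g has_real_derivative D) (at x within T)"
  shows "D = m"
proof -
  have "x islimpt {c<..<d}"
  proof (cases "x \<in> {c<..<d}")
    case True
    then show ?thesis by (intro interior_limit_point) (simp add: interior_open)
  next
    case False
    then have "x = c \<or> x = d" using x by auto
    then show ?thesis
      using islimpt_greaterThanLessThan1[OF cd] islimpt_greaterThanLessThan2[OF cd] by auto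
  qed
  then have nt: "at x within {c<..<d} \<noteq> bot" by (simp add: trivial_limit_within)
  have eq: "eventually (\<lambda>y. g y = m * y + q) (at x within {c<..<d})"
    using g by (auto simp: eventually_at_filter)
  have subT: "{c<..<d} \<subseteq> T" using sub by (meson greaterThanLessThan_subseteq_atLeastAtMost_iff order_refl order_trans)
  have "(g \<longlongrightarrow> g x) (at x within T)"
    using DERIV_continuous[OF deriv] by (simp add: continuous_within)
  then have "(g \<longlongrightarrow> g x) (at x within {c<..<d})" using subT by (rule tendsto_within_subset)
  then have "((\<lambda>y. m * y + q) \<longlongrightarrow> g x) (at x within {c<..<d})" using eq by (rule Lim_transform_eventually)
  moreover have "((\<lambda>y. m * y + q) \<longlongrightarrow> m * x + q) (at x within {c<..<d})" by (intro tendsto_intros)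
  ultimately have gx: "g x = m * x + q" using tendsto_unique[OF nt] by blast
  have "((\<lambda>y. (g y - g x) / (y - x)) \<longlongrightarrow> D) (at x within T)"
    using deriv by (simp add: has_field_derivative_iff)
  then have "((\<lambda>y. (g y - g x) / (y - x)) \<longlongrightarrow> D) (at x within {c<..<d})" using subT by (rule tendsto_within_subset)
  moreover have "eventually (\<lambda>y. (g y - g x) / (y - x) = m) (at x within {c<..<d})"
    unfolding eventually_at_filter
  proof (intro always_eventually allI impI)
    fix y assume "y \<noteq> x" "y \<in> {c<..<d}"
    then have "g y - g x = m * (y - x)" using g gx by (simp add: algebra_simps)
    then show "(g y - g x) / (y - x) = m" using \<open>y \<noteq> x\<close> by simp
  qed
  ultimately have "((\<lambda>y. m) \<longlongrightarrow> D) (at x within {c<..<d})" by (rule Lim_transform_eventually)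
  then show ?thesis using tendsto_unique[OF nt tendsto_const] by blast
qed

text \<open>The pieces are the images of the given intervals, whether or not these are laps of the
  new map. Values at their ends are inherited from \<open>f\<close>; both \<open>branch\<close> and
  the derivative are evaluated by limits from inside a piece.\<close>

lemma CS_of_affine_conjugacy:
  assumes D: "lap_system a b D F" and "\<beta> > 0" and homeo: "homeomorphism {a..b} {0..1} \<psi> \<psi>'"
    and sm: "strict_mono_on {a..b} \<psi>"
    and affine: "\<And>J. J \<in> D \<Longrightarrow> \<exists>m q. \<bar>m\<bar> = \<beta> \<and> (\<forall>x\<in>J. \<psi> (F J x) = m * \<psi> x + q)"
    and F: "\<And>J x. J \<in> D \<Longrightarrow> x \<in> interior J \<Longrightarrow> f x = F J x" and maps: "f ` {a..b} \<subseteq> {a..b}"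
  shows "\<psi> \<circ> f \<circ> \<psi>' \<in> CS \<beta>"
    and "\<And>J x. J \<in> D \<Longrightarrow> x \<in> J \<Longrightarrow> \<psi> (F J x) = branch (\<psi> \<circ> f \<circ> \<psi>') (\<psi> ` J) (\<psi> x)"
proof -
  interpret lap_system a b D F by fact
  let ?g = "\<psi> \<circ> f \<circ> \<psi>'"
  have inv: "\<And>x. x \<in> {a..b} \<Longrightarrow> \<psi>' (\<psi> x) = x" and cont: "continuous_on {a..b} \<psi>"
    and im: "\<psi> ` {a..b} = {0..1}" and im': "\<psi>' ` {0..1} = {a..b}"
    using homeo by (auto simp: homeomorphism_def)
  have piece: "\<exists>c d m q. c < d \<and> J = {c..d} \<and> \<psi> ` J = {\<psi> c..\<psi> d} \<and> \<psi> c < \<psi> d \<and> \<bar>m\<bar> = \<beta>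
      \<and> (\<forall>y\<in>{\<psi> c<..<\<psi> d}. ?g y = m * y + q) \<and> (\<forall>x\<in>J. \<psi> (F J x) = m * \<psi> x + q)"
    if J: "J \<in> D" for J
  proof -
    obtain c d where cd: "c < d" "J = {c..d}" "a \<le> c" "d \<le> b" using D_Icc[OF J] by metis
    obtain m q where mq: "\<bar>m\<bar> = \<beta>" "\<And>x. x \<in> J \<Longrightarrow> \<psi> (F J x) = m * \<psi> x + q" using affine[OF J] by metis
    have sub: "{c..d} \<subseteq> {a..b}" using cd by auto
    have imJ: "\<psi> ` J = {\<psi> c..\<psi> d}"
      unfolding cd(2) using cd(1) sub cont sm
      by (intro image_Icc_strict_mono) (auto intro: continuous_on_subset monotone_on_subset)
    have lt: "\<psi> c < \<psi> d" using sm cd by (intro strict_mono_onD[of "{a..b}" \<psi>]) auto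
    have "?g y = m * y + q" if y: "y \<in> {\<psi> c<..<\<psi> d}" for y
    proof -
      have "y \<in> \<psi> ` J" unfolding imJ using y by auto
      then obtain x where x: "x \<in> J" "y = \<psi> x" by blast
      then have "x \<noteq> c" "x \<noteq> d" using y by auto
      then have int: "x \<in> interior J" using x(1) unfolding cd(2) by (simp add: interior_atLeastAtMost_real)
      have "x \<in> {a..b}" using x(1) sub unfolding cd(2) by blast
      then have "?g y = \<psi> (F J x)" using x(2) inv F[OF J int] by simp
      then show ?thesis using mq(2)[OF x(1)] x(2) by simp
    qed
    then show ?thesis using cd imJ lt mq by blast
  qed
  have disj: "interior (\<psi> ` J) \<inter> interior (\<psi> ` J') = {}" if J: "J \<in> D" "J' \<in> D" "\<psi> ` J \<noteq> \<psi> ` J'" for J J'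
  proof (rule ccontr)
    assume "interior (\<psi> ` J) \<inter> interior (\<psi> ` J') \<noteq> {}"
    then have "nontrivial (\<psi> ` J \<inter> \<psi> ` J')" by (intro nontrivial_if_interior) simp
    moreover have inj: "inj_on \<psi> {a..b}" using inv by (rule inj_on_inverseI)
    have "\<psi> ` J \<inter> \<psi> ` J' = \<psi> ` (J \<inter> J')"
      using inj_on_image_Int[OF inj D_sub[OF J(1)] D_sub[OF J(2)]] by simp
    moreover have "inj_on \<psi> (J \<inter> J')" using inj D_sub[OF J(1)] by (meson inf_le1 inj_on_subset order_trans)
    ultimately have "nontrivial (J \<inter> J')" by (simp add: nontrivial_inj_image)
    then show False using disj_D[OF J(1,2)] J(3) by auto
  qed
  let ?P = "(`) \<psi> ` D"
  have div: "?P division_of {0..1}"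
  proof (rule division_ofI)
    show "finite ?P" using fin_D by simp
    have "\<Union>?P = \<psi> ` \<Union>D" by (simp add: image_Union)
    then show un: "\<Union>?P = {0..1}" using cover im by simp
    show "K \<subseteq> {0..1}" if "K \<in> ?P" for K using that un by blast
    show "K \<noteq> {}" "\<exists>a b. K = cbox a b" if K: "K \<in> ?P" for K
    proof -
      obtain J where J: "J \<in> D" "K = \<psi> ` J" using K by blast
      obtain c d where "\<psi> ` J = {\<psi> c..\<psi> d}" "\<psi> c < \<psi> d" using piece[OF J(1)] by metis
      then show "K \<noteq> {}" "\<exists>a b. K = cbox a b" unfolding J(2) by (auto simp: cbox_interval)
    qed
    show "interior K1 \<inter> interior K2 = {}" if K: "K1 \<in> ?P" "K2 \<in> ?P" "K1 \<noteq> K2" for K1 K2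
    proof -
      obtain J1 J2 where "J1 \<in> D" "K1 = \<psi> ` J1" "J2 \<in> D" "K2 = \<psi> ` J2" using K(1,2) by blast
      then show ?thesis using disj[of J1 J2] K(3) by simp
    qed
  qed
  have pcs: "nd_interval K \<and> cont_monotone_on (interior K) ?g \<and> (\<exists>m q. \<forall>x\<in>interior K. ?g x = m * x + q)"
    if K: "K \<in> ?P" for K
  proof -
    obtain J where J: "J \<in> D" "K = \<psi> ` J" using K by blast
    obtain c d m q where p: "\<psi> ` J = {\<psi> c..\<psi> d}" "\<psi> c < \<psi> d" "\<bar>m\<bar> = \<beta>"
      "\<And>y. y \<in> {\<psi> c<..<\<psi> d} \<Longrightarrow> ?g y = m * y + q" using piece[OF J(1)] by metis
    have "cont_monotone_on {\<psi> c<..<\<psi> d} (\<lambda>y. m * y + q)"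
    proof (rule cont_inj_imp_cont_monotone)
      show "inj_on (\<lambda>y. m * y + q) {\<psi> c<..<\<psi> d}" using p(3) \<open>\<beta> > 0\<close> by (auto simp: inj_on_def)
    qed (auto intro!: continuous_intros simp: is_interval_oo)
    then have "cont_monotone_on {\<psi> c<..<\<psi> d} ?g"
      using cont_monotone_on_cong[of "{\<psi> c<..<\<psi> d}" ?g "\<lambda>y. m * y + q"] p(4) by simp
    moreover have "interior K = {\<psi> c<..<\<psi> d}" unfolding J(2) p(1) by (simp add: interior_atLeastAtMost_real)
    moreover have "nd_interval K" unfolding J(2) p(1) nd_interval_def using p(2) by blast
    ultimately show ?thesis using p(4) by metis
  qed
  have "?g ` {0..1} = \<psi> ` f ` \<psi>' ` {0..1}" by (simp add: image_comp comp_assoc)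
  also have "\<dots> \<subseteq> {0..1}" unfolding im' using image_mono[OF maps, of \<psi>] im by simp
  finally have "pcpm {0..1} ?g" unfolding pcpm_def using div pcs by blast
  moreover have "piecewise_affine {0..1} ?g" unfolding piecewise_affine_def using div pcs by blast
  moreover have "\<bar>D'\<bar> = \<beta>"
    if x: "x \<in> {0..1}" and der: "(?g has_real_derivative D') (at x within {0..1})" for x D'
  proof -
    have "x \<in> \<Union>?P" using x division_ofD(6)[OF div] by simp
    then obtain J where J: "J \<in> D" "x \<in> \<psi> ` J" by blast
    obtain c d m q where p: "\<psi> ` J = {\<psi> c..\<psi> d}" "\<psi> c < \<psi> d" "\<bar>m\<bar> = \<beta>"
      "\<And>y. y \<in> {\<psi> c<..<\<psi> d} \<Longrightarrow> ?g y = m * y + q" using piece[OF J(1)] by metis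
    have "\<psi> ` J \<subseteq> {0..1}" using image_mono[OF D_sub[OF J(1)], of \<psi>] im by simp
    then have "D' = m" using derivative_eq_slope[OF p(2,4) _ _ der] J(2) unfolding p(1) by simp
    then show ?thesis using p(3) by simp
  qed
  ultimately show "?g \<in> CS \<beta>" unfolding CS_def by blast
  show "\<psi> (F J x) = branch ?g (\<psi> ` J) (\<psi> x)" if J: "J \<in> D" and x: "x \<in> J" for J x
  proof -
    obtain c d m q where p: "\<psi> ` J = {\<psi> c..\<psi> d}" "\<psi> c < \<psi> d"
      "\<And>y. y \<in> {\<psi> c<..<\<psi> d} \<Longrightarrow> ?g y = m * y + q" "\<And>x. x \<in> J \<Longrightarrow> \<psi> (F J x) = m * \<psi> x + q"
      using piece[OF J] by metis
    have "\<psi> x \<in> {\<psi> c..\<psi> d}" using x p(1) by blast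
    \<comment> \<open>The affine formula is the continuous extension to the closed piece.\<close>
    then have "branch ?g {\<psi> c..\<psi> d} (\<psi> x) = m * \<psi> x + q"
      by (intro branch_eq_extension[OF p(2)]) (auto intro!: continuous_intros simp: p(3)[unfolded comp_apply])
    then show ?thesis using p(4)[OF x] p(1) by simp
  qed
qed

theorem corollary2:
  fixes a b \<beta> :: real and f :: "real \<Rightarrow> real"
  assumes "a < b"
    and "pcpm {a..b} f"
    and "transitive_map {a..b} f"
    and "\<beta> > 0"
    and "has_entropy {a..b} f (ln \<beta>)"
    and "ln \<beta> > 0"
  shows "\<exists>\<psi> \<psi>' g. homeomorphism {a..b} {0..1} \<psi> \<psi>' \<and> strict_mono_on {a..b} \<psi> \<and>
           g \<in> CS \<beta> \<and> conjugate_via {a..b} \<psi> f g"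
proof -
  obtain x0 where x0: "x0 \<in> {a..b}" "{a..b} \<subseteq> closure (range (\<lambda>n. (f ^^ n) x0))"
    using assms(3) unfolding transitive_map_def by blast
  have nc: "nowhere_constant_on {a..b} f" by (rule transitive_nowhere_constant[OF assms(1) x0(2)])
  have sys: "lap_system a b (laps {a..b} f) (branch f)" by (rule lap_system_laps[OF assms(1,2) nc])
  have "\<beta> > 1" using assms(4,6) by simp
  then have grow: "growing_lap_system a b (laps {a..b} f) (branch f) \<beta>"
    by (rule growing_lap_system_laps[OF sys assms(5)])
  interpret growing_lap_system a b "laps {a..b} f" "branch f" \<beta> by (rule grow)
  have br: "f x = branch f J x" if "x \<in> interior J" for J x using that by (simp add: branch_def)
  have maps: "f ` {a..b} \<subseteq> {a..b}" using assms(2) by (simp add: pcpm_def)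
  obtain \<psi> where \<psi>: "mono_on {a..b} \<psi>" "\<psi> a = 0" "\<psi> b = 1"
    and scale: "\<And>J c d. J \<in> laps {a..b} f \<Longrightarrow> c \<in> J \<Longrightarrow> d \<in> J \<Longrightarrow>
      \<bar>\<psi> (branch f J d) - \<psi> (branch f J c)\<bar> = \<beta> * \<bar>\<psi> d - \<psi> c\<bar>"
    using exists_semiconjugacy by metis
  have cont: "continuous_on {a..b} \<psi>" by (rule semiconjugacy_continuous[OF \<psi> scale])
  have affine: "\<exists>m q. \<bar>m\<bar> = \<beta> \<and> (\<forall>x\<in>J. \<psi> (branch f J x) = m * \<psi> x + q)" if "J \<in> laps {a..b} f" for J
    by (rule semiconjugacy_affine[OF \<psi>(1) scale that])
  have inj: "inj_on \<psi> {a..b}"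
    by (rule semiconjugacy_inj[OF \<psi>(1) cont \<psi>(2,3) affine br maps x0])
  have sm: "strict_mono_on {a..b} \<psi>" using \<psi>(1) inj by (simp add: strict_mono_iff_mono)
  have "\<psi> ` {a..b} = {0..1}"
    using image_Icc_strict_mono[OF _ cont sm] assms(1) \<psi>(2,3) by simp
  then obtain \<psi>' where homeo: "homeomorphism {a..b} {0..1} \<psi> \<psi>'"
    using homeomorphism_compact[OF compact_Icc cont _ inj] by blast
  have "\<psi> \<circ> f \<circ> \<psi>' \<in> CS \<beta>"
    by (rule CS_of_affine_conjugacy(1)[OF sys assms(4) homeo sm affine br maps])
  moreover have "conjugate_via {a..b} \<psi> f (\<psi> \<circ> f \<circ> \<psi>')"
    unfolding conjugate_via_def
    using CS_of_affine_conjugacy(2)[OF sys assms(4) homeo sm affine br maps] by blast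
  ultimately show ?thesis using homeo sm by blast
qed

end
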